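(* Let $\varepsilon,\delta,C$ be positive real numbers and let $k=k(n)$ be an integer with $2\le k\le Cnp$. Then, for all sufficiently large $n$, \[ \mathbb{P}(X\geq(1+\delta)\mathbb{E}[X])\geq \begin{cases} \left( p^{m_k} \binom{n}{m_k/k}\right)^{1+\varepsilon} &\text{ if } n^{-1}\ll p\ll n^{-1/2}, \\ p^{(1+\varepsilon)m_*} &\text{ if } n^{-1/2}\ll p\ll 1. \end{cases} \]
   Context: $G_{n,p}$ is the binomial random graph on $[n]$ with edge probability $p=p(n)$, and $X$ is the number of induced copies of $C_4$ in $G_{n,p}$; $\mathbb{E}[X]=3\binom n4p^4(1-p)^2$. Asymptotics are as $n\to\infty$; $a\ll b$ means $a/b\to0$. For integers $k\ge2$ let $r_k=2\sqrt{k/(k-1)}$ and $m_k=r_k\sqrt{(\delta+\varepsilon)\mathbb{E}[X]}$. Let $m_*=\big(\sqrt{r+d^2}-d\big)\sqrt{\mathbb{E}[X]}/2$ where $r=16(\delta+3\varepsilon/2)$ and $d=\sqrt2/(1+\varepsilon)$. As in the paper, the quantities $m_k/k$, $2m_*/n$ and $n/2$ are assumed to be integers. *)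

theory Defs
  imports "HOL-Probability.Probability" "HOL-Library.Landau_Symbols"
begin

text \<open>A simple graph on a given vertex set is represented by its set of edges,
  each edge being a two-element set of vertices.\<close>

definition all_edges :: "'a set \<Rightarrow> 'a set set" where
  "all_edges V = {e. e \<subseteq> V \<and> card e = 2}"

definition binomial_random_graph :: "nat \<Rightarrow> real \<Rightarrow> nat set set pmf" where
  "binomial_random_graph n p =
     map_pmf (\<lambda>f. {e \<in> all_edges {1..n}. f e})
       (Pi_pmf (all_edges {1..n}) False (\<lambda>_. bernoulli_pmf p))"

definition induced_edges :: "'a set set \<Rightarrow> 'a set \<Rightarrow> 'a set set" where
  "induced_edges E S = {e \<in> E. e \<subseteq> S}"

definition graph_isomorphic :: "'a set \<Rightarrow> 'a set set \<Rightarrow> 'b set \<Rightarrow> 'b set set \<Rightarrow> bool" where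
  "graph_isomorphic V E W F \<longleftrightarrow> (\<exists>f. bij_betw f V W \<and> (\<lambda>e. f ` e) ` E = F)"

definition C4_vertices :: "nat set" where
  "C4_vertices = {0, 1, 2, 3}"

definition C4_edges :: "nat set set" where
  "C4_edges = {{0, 1}, {1, 2}, {2, 3}, {3, 0}}"

text \<open>An induced copy is determined by its vertex set, so induced copies are counted as
  vertex subsets.\<close>

definition num_induced_C4 :: "nat \<Rightarrow> nat set set \<Rightarrow> nat" where
  "num_induced_C4 n E =
     card {S. S \<subseteq> {1..n} \<and> graph_isomorphic S (induced_edges E S) C4_vertices C4_edges}"

definition expected_C4 :: "nat \<Rightarrow> real \<Rightarrow> real" where
  "expected_C4 n p =
     measure_pmf.expectation (binomial_random_graph n p) (\<lambda>E. real (num_induced_C4 n E))"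

definition upper_tail_C4 :: "nat \<Rightarrow> real \<Rightarrow> real \<Rightarrow> real" where
  "upper_tail_C4 n p \<delta> =
     measure_pmf.prob (binomial_random_graph n p)
       {E. real (num_induced_C4 n E) \<ge> (1 + \<delta>) * expected_C4 n p}"

definition r_seq :: "nat \<Rightarrow> real" where
  "r_seq k = 2 * sqrt (real k / (real k - 1))"

text \<open>In the next two definitions \<open>\<mu>\<close> stands for the expected number of induced copies.\<close>

definition m_seq :: "real \<Rightarrow> real \<Rightarrow> real \<Rightarrow> nat \<Rightarrow> real" where
  "m_seq \<delta> \<epsilon> \<mu> k = r_seq k * sqrt ((\<delta> + \<epsilon>) * \<mu>)"

definition m_star :: "real \<Rightarrow> real \<Rightarrow> real \<Rightarrow> real" where
  "m_star \<delta> \<epsilon> \<mu> =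
     (let r = 16 * (\<delta> + 3 * \<epsilon> / 2); d = sqrt 2 / (1 + \<epsilon>)
      in (sqrt (r + d\<^sup>2) - d) * sqrt \<mu> / 2)"

end

theory Submission
  imports Defs
begin

text \<open>
  An induced \<open>C\<^sub>4\<close> is an unordered pair of disjoint non-edges (its diagonals) all of whose four
  crossing pairs are edges; this makes every expectation below a sum of monomials in \<open>p\<close> and \<open>1 - p\<close>.

  The lower bound comes from planting a complete bipartite graph between \<open>S\<close> and \<open>T\<close>, where in the
  sparse range \<open>|S| = k\<close> and \<open>|T| = m/k\<close>, and in the dense range \<open>|S| = 2m/n\<close> and \<open>|T| = n/2\<close>. Copies with
  one diagonal in \<open>S\<close> and the other in \<open>T\<close>, copies with one diagonal in \<open>T\<close> and a single vertex in \<open>S\<close>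
  (dense range only), and copies avoiding \<open>S\<close> raise the conditional expectation to
  \<open>(1 + \<delta> + \<epsilon>/2) E[X]\<close>. No concentration is needed: as \<open>X \<le> n^4\<close>, the reverse Markov inequality
  gives conditional probability at least \<open>(\<epsilon>/2) E[X] / n^4\<close>, of order \<open>p^4\<close>, for the upper tail event,
  and the exponent \<open>1 + \<epsilon>\<close> absorbs this factor. In the sparse range \<open>S\<close> is fixed and \<open>T\<close> is free, the events
  that the common neighbourhood of \<open>S\<close> is exactly \<open>T\<close> being disjoint; this produces the binomial
  coefficient.
\<close>

subsection \<open>Induced 4-cycles as pairs of diagonals\<close>

text \<open>For disjoint arguments this is the edge set of the complete bipartite graph between
  them; overlapping arguments also yield singletons, so disjointness is required wherever the edges
  are counted.\<close>

definition crossing :: "'a set \<Rightarrow> 'a set \<Rightarrow> 'a set set" where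
  "crossing P R = (\<lambda>(x, y). {x, y}) ` (P \<times> R)"

definition C4_pair :: "'a set set \<Rightarrow> 'a set \<Rightarrow> 'a set \<Rightarrow> bool" where
  "C4_pair E P R \<longleftrightarrow> P \<notin> E \<and> R \<notin> E \<and> crossing P R \<subseteq> E"

text \<open>Pairs are ordered, so each induced 4-cycle will appear twice. The dependent-sum form
  makes the cardinality a product of two binomial coefficients.\<close>

definition disjoint_pairs :: "'a set \<Rightarrow> ('a set \<times> 'a set) set" where
  "disjoint_pairs V = (SIGMA P:all_edges V. all_edges (V - P))"

lemma finite_all_edges [simp]: "finite V \<Longrightarrow> finite (all_edges V)"
  unfolding all_edges_def by (rule finite_subset[of _ "Pow V"]) auto

lemma card_all_edges: "finite V \<Longrightarrow> card (all_edges V) = card V choose 2"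
  unfolding all_edges_def by (rule n_subsets)

lemma finite_disjoint_pairs [simp]: "finite V \<Longrightarrow> finite (disjoint_pairs V)"
  unfolding disjoint_pairs_def by (intro finite_SigmaI) auto

lemma card_disjoint_pairs:
  assumes "finite V"
  shows "card (disjoint_pairs V) = (card V choose 2) * ((card V - 2) choose 2)"
proof -
  have "card (disjoint_pairs V) = (\<Sum>P\<in>all_edges V. card (all_edges (V - P)))"
    unfolding disjoint_pairs_def using assms by (intro card_SigmaI) auto
  also have "\<dots> = (\<Sum>P\<in>all_edges V. (card V - 2) choose 2)"
    using assms
    by (intro sum.cong refl, subst card_all_edges)
       (auto simp: all_edges_def card_Diff_subset finite_subset)
  finally show ?thesis
    using assms by (simp add: card_all_edges)
qed

lemma crossing_commute: "crossing P R = crossing R P"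
  by (auto simp: crossing_def insert_commute)

lemma finite_crossing [simp]: "finite P \<Longrightarrow> finite R \<Longrightarrow> finite (crossing P R)"
  by (simp add: crossing_def)

lemma crossing_mono: "P \<subseteq> P' \<Longrightarrow> R \<subseteq> R' \<Longrightarrow> crossing P R \<subseteq> crossing P' R'"
  by (auto simp: crossing_def)

lemma card_crossing:
  assumes "P \<inter> R = {}"
  shows "card (crossing P R) = card P * card R"
proof -
  have "inj_on (\<lambda>(x, y). {x, y}) (P \<times> R)"
    using assms by (auto simp: inj_on_def doubleton_eq_iff)
  then show ?thesis
    by (simp add: crossing_def card_image card_cartesian_product)
qed

lemma crossing_subset_all_edges:
  assumes "P \<subseteq> V" "R \<subseteq> V" "P \<inter> R = {}"
  shows "crossing P R \<subseteq> all_edges V"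
  using assms by (auto simp: crossing_def all_edges_def card_insert_if)

text \<open>The non-edges \<open>{0, 2}\<close> and \<open>{1, 3}\<close> of the model cycle pull
  back to the diagonals; conversely, labelling the vertices alternately from \<open>P\<close> and
  \<open>R\<close> gives the isomorphism. The hypothesis on \<open>E\<close> rules out members of
  \<open>E\<close> inside \<open>S\<close> that are not pairs.\<close>

lemma induced_C4_iff:
  assumes E: "\<forall>e\<in>E. card e = 2"
  shows "graph_isomorphic S (induced_edges E S) C4_vertices C4_edges \<longleftrightarrow>
    (\<exists>P R. P \<union> R = S \<and> card P = 2 \<and> card R = 2 \<and> P \<inter> R = {} \<and> C4_pair E P R)"
proof
  assume "graph_isomorphic S (induced_edges E S) C4_vertices C4_edges"
  then obtain f where f: "bij_betw f S C4_vertices"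
    and im: "(\<lambda>e. f ` e) ` induced_edges E S = C4_edges"
    unfolding graph_isomorphic_def by auto
  \<comment> \<open>The equality of images only yields some edge with the same image as
    \<open>e\<close>; injectivity of \<open>f\<close> on \<open>S\<close> identifies it with
    \<open>e\<close>.\<close>
  have edge: "e \<in> E \<longleftrightarrow> f ` e \<in> C4_edges" if "e \<subseteq> S" for e
  proof
    assume "e \<in> E" then show "f ` e \<in> C4_edges"
      using that im by (auto simp: induced_edges_def)
  next
    assume "f ` e \<in> C4_edges"
    then obtain e' where "e' \<in> E" "e' \<subseteq> S" "f ` e = f ` e'"
      using im[symmetric] unfolding induced_edges_def by blast
    then show "e \<in> E"
      using f that by (metis bij_betw_def inj_on_image_eq_iff)
  qed
  define g where "g = inv_into S f"
  have g: "bij_betw g C4_vertices S"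
    unfolding g_def using f by (rule bij_betw_inv_into)
  have fg: "f (g i) = i" if "i \<in> C4_vertices" for i
    unfolding g_def using f that by (simp add: bij_betw_inv_into_right)
  have fg': "f (g 0) = 0" "f (g 1) = 1" "f (g 2) = 2" "f (g 3) = 3"
    by (auto intro!: fg simp: C4_vertices_def)
  have S: "S = {g 0, g 1, g 2, g 3}"
    using g by (auto simp: bij_betw_def C4_vertices_def)
  have dist: "g i \<noteq> g j" if "i \<noteq> j" "i \<in> C4_vertices" "j \<in> C4_vertices" for i j
    using g that by (auto simp: bij_betw_def inj_on_def)
  have dist': "g 0 \<noteq> g 1" "g 0 \<noteq> g 2" "g 0 \<noteq> g 3" "g 1 \<noteq> g 2" "g 1 \<noteq> g 3" "g 2 \<noteq> g 3"
    using dist[of 0 1] dist[of 0 2] dist[of 0 3] dist[of 1 2] dist[of 1 3] dist[of 2 3]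
    by (auto simp: C4_vertices_def)
  have pair: "{g i, g j} \<in> E \<longleftrightarrow> {i, j} \<in> C4_edges" if "i \<in> C4_vertices" "j \<in> C4_vertices" for i j
    using that by (subst edge) (auto simp: fg C4_vertices_def S)
  have "C4_pair E {g 0, g 2} {g 1, g 3}"
    unfolding C4_pair_def crossing_def
    by (auto simp: pair C4_vertices_def) (auto simp: C4_edges_def doubleton_eq_iff)
  with dist' show "\<exists>P R. P \<union> R = S \<and> card P = 2 \<and> card R = 2 \<and> P \<inter> R = {} \<and> C4_pair E P R"
    by (intro exI[of _ "{g 0, g 2}"] exI[of _ "{g 1, g 3}"]) (auto simp: S)
next
  assume "\<exists>P R. P \<union> R = S \<and> card P = 2 \<and> card R = 2 \<and> P \<inter> R = {} \<and> C4_pair E P R"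
  then obtain P R where PR: "P \<union> R = S" "card P = 2" "card R = 2" "P \<inter> R = {}" "C4_pair E P R"
    by blast
  obtain a c where P: "P = {a, c}" "a \<noteq> c" using PR(2) by (auto simp: card_2_iff)
  obtain b d where R: "R = {b, d}" "b \<noteq> d" using PR(3) by (auto simp: card_2_iff)
  have ne: "a \<noteq> b" "a \<noteq> d" "c \<noteq> b" "c \<noteq> d" using PR(4) P R by auto
  \<comment> \<open>Cyclic order \<open>a, b, c, d\<close>, with \<open>P = {a, c}\<close> on the
    even labels; the default value 3 is the label of \<open>d\<close>.\<close>
  define f where "f = (\<lambda>x. if x = a then 0 else if x = b then 1 else if x = c then 2 else (3::nat))"
  have f: "f a = 0" "f b = 1" "f c = 2" "f d = 3"
    using P R ne by (auto simp: f_def)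
  have S: "S = {a, b, c, d}" using PR(1) P R by auto
  have "bij_betw f S C4_vertices"
    unfolding bij_betw_def S C4_vertices_def inj_on_def by (simp add: f)
  moreover have "induced_edges E S = {{a, b}, {b, c}, {c, d}, {d, a}}"
  proof
    show "{{a, b}, {b, c}, {c, d}, {d, a}} \<subseteq> induced_edges E S"
      using PR(5) unfolding C4_pair_def crossing_def P R induced_edges_def S
      by (auto simp: insert_commute)
    show "induced_edges E S \<subseteq> {{a, b}, {b, c}, {c, d}, {d, a}}"
    proof
      fix e assume "e \<in> induced_edges E S"
      then have e: "e \<in> E" "e \<subseteq> S" by (auto simp: induced_edges_def)
      then obtain x y where xy: "e = {x, y}" "x \<noteq> y" using E by (auto simp: card_2_iff)
      have "x \<in> {a, b, c, d}" "y \<in> {a, b, c, d}" using e xy S by auto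
      moreover have "{a, c} \<notin> E" "{b, d} \<notin> E" "{c, a} \<notin> E" "{d, b} \<notin> E"
        using PR(5) unfolding C4_pair_def P R by (auto simp: insert_commute)
      ultimately show "e \<in> {{a, b}, {b, c}, {c, d}, {d, a}}"
        using xy e(1) by (auto simp: doubleton_eq_iff)
    qed
  qed
  ultimately show "graph_isomorphic S (induced_edges E S) C4_vertices C4_edges"
    unfolding graph_isomorphic_def
    by (intro exI[of _ f]) (auto simp: f C4_edges_def)
qed

text \<open>A vertex set carries at most one such unordered pair: any nonadjacent pair inside
  \<open>P \<union> R\<close> avoids all crossing edges, so it is \<open>P\<close> or \<open>R\<close>.\<close>

lemma C4_pair_unique:
  assumes PR: "C4_pair E P R" "card P = 2" "card R = 2" "P \<inter> R = {}"
    and PR': "C4_pair E P' R'" "card P' = 2" "card R' = 2" "P' \<inter> R' = {}"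
    and eq: "P' \<union> R' = P \<union> R"
  shows "(P', R') = (P, R) \<or> (P', R') = (R, P)"
proof -
  have "P' \<subseteq> P \<or> P' \<subseteq> R"
  proof (rule ccontr)
    assume "\<not> ?thesis"
    then obtain x y where xy: "x \<in> P'" "y \<in> P'" "x \<in> P" "y \<in> R"
      using eq by blast
    then have "x \<noteq> y" using PR(4) by auto
    then have "P' = {x, y}" using xy PR'(2) by (auto simp: card_2_iff)
    then have "P' \<in> crossing P R" using xy by (auto simp: crossing_def)
    then show False using PR(1) PR'(1) by (auto simp: C4_pair_def)
  qed
  moreover have "finite P" "finite R" using PR by (auto intro: card_ge_0_finite)
  ultimately have "P' = P \<or> P' = R"
    using PR PR' by (metis card_subset_eq)
  then show ?thesis using PR(4) PR'(4) eq by auto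
qed

text \<open>Double counting along \<open>(P, R) \<mapsto> P \<union> R\<close>: by
  \<open>C4_pair_unique\<close> the fibre over each induced copy is exactly
  \<open>{(P, R), (R, P)}\<close>.\<close>

lemma num_induced_C4_pairs:
  assumes E: "E \<subseteq> all_edges {1..n}"
  shows "2 * num_induced_C4 n E = card {(P, R) \<in> disjoint_pairs {1..n}. C4_pair E P R}"
proof -
  define Q where "Q = {(P, R) \<in> disjoint_pairs {1..n}. C4_pair E P R}"
  define A where
    "A = {S. S \<subseteq> {1..n} \<and> graph_isomorphic S (induced_edges E S) C4_vertices C4_edges}"
  have E2: "\<forall>e\<in>E. card e = 2" using E by (auto simp: all_edges_def)
  have Q: "(P, R) \<in> Q \<longleftrightarrow> P \<union> R \<subseteq> {1..n} \<and> card P = 2 \<and> card R = 2 \<and> P \<inter> R = {} \<and> C4_pair E P R" for P R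
    by (auto simp: Q_def disjoint_pairs_def all_edges_def)
  have finQ: "finite Q"
    unfolding Q_def by (rule finite_subset[of _ "disjoint_pairs {1..n}"]) auto
  have finA: "finite A"
    unfolding A_def by (rule finite_subset[of _ "Pow {1..n}"]) auto
  have fibre: "card {q \<in> Q. fst q \<union> snd q = S} = 2" if "S \<in> A" for S
  proof -
    from that have S: "S \<subseteq> {1..n}" "graph_isomorphic S (induced_edges E S) C4_vertices C4_edges"
      by (auto simp: A_def)
    from S(2) obtain P R where PR: "P \<union> R = S" "card P = 2" "card R = 2" "P \<inter> R = {}" "C4_pair E P R"
      unfolding induced_C4_iff[OF E2] by blast
    have sw: "C4_pair E R P" using PR(5) by (auto simp: C4_pair_def crossing_commute)
    have "{q \<in> Q. fst q \<union> snd q = S} = {(P, R), (R, P)}"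
    proof (intro equalityI subsetI)
      fix q assume "q \<in> {q \<in> Q. fst q \<union> snd q = S}"
      then obtain P' R' where q: "q = (P', R')" "(P', R') \<in> Q" "P' \<union> R' = S"
        by (cases q) auto
      show "q \<in> {(P, R), (R, P)}"
        using C4_pair_unique[OF PR(5,2,3,4), of P' R'] q PR(1) by (simp add: Q)
    next
      fix q assume "q \<in> {(P, R), (R, P)}"
      then show "q \<in> {q \<in> Q. fst q \<union> snd q = S}"
        using PR sw S by (auto simp: Q)
    qed
    moreover have "P \<noteq> R" using PR by auto
    ultimately show ?thesis by (simp add: card_insert_if)
  qed
  have "card Q = (\<Sum>S\<in>A. \<Sum>q | q \<in> Q \<and> fst q \<union> snd q = S. 1)"
  proof (subst sum.group[OF finQ finA])
    show "(\<lambda>q. fst q \<union> snd q) ` Q \<subseteq> A"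
      unfolding A_def induced_C4_iff[OF E2] using Q by (auto simp del: atLeastAtMost_iff) blast
  qed simp
  also have "\<dots> = (\<Sum>S\<in>A. 2)"
    using fibre by (intro sum.cong) auto
  finally show ?thesis by (simp add: Q_def A_def num_induced_C4_def)
qed

subsection \<open>Conditioning on a set of edges\<close>

text \<open>The event is a product event, so independence of the coordinates gives one factor per
  edge: \<open>p\<close> on \<open>Y\<close>, \<open>1 - p\<close> on \<open>N\<close> and 1
  elsewhere.\<close>

lemma prob_edge_pattern:
  assumes "finite A" "Y \<subseteq> A" "N \<subseteq> A" "Y \<inter> N = {}" "0 \<le> p" "p \<le> (1::real)"
  shows "measure_pmf.prob (Pi_pmf A False (\<lambda>_. bernoulli_pmf p))
           {f. (\<forall>e\<in>Y. f e) \<and> (\<forall>e\<in>N. \<not> f e)} = p ^ card Y * (1 - p) ^ card N"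
proof -
  define B where "B = (\<lambda>e. if e \<in> Y then {True} else if e \<in> N then {False} else UNIV)"
  have eq: "{f. (\<forall>e\<in>Y. f e) \<and> (\<forall>e\<in>N. \<not> f e)} = Pi A B"
  proof (intro equalityI subsetI)
    fix f assume "f \<in> {f. (\<forall>e\<in>Y. f e) \<and> (\<forall>e\<in>N. \<not> f e)}"
    then show "f \<in> Pi A B" by (auto simp: B_def)
  next
    fix f assume f: "f \<in> Pi A B"
    have "f e" if "e \<in> Y" for e
      using f[THEN Pi_mem, of e] that assms(2) by (auto simp: B_def)
    moreover have "\<not> f e" if "e \<in> N" for e
    proof -
      have "e \<in> A" "e \<notin> Y" using that assms(3,4) by auto
      then show ?thesis using f[THEN Pi_mem, of e] that by (auto simp: B_def)
    qed
    ultimately show "f \<in> {f. (\<forall>e\<in>Y. f e) \<and> (\<forall>e\<in>N. \<not> f e)}" by simp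
  qed
  have "measure_pmf.prob (Pi_pmf A False (\<lambda>_. bernoulli_pmf p)) (Pi A B)
      = (\<Prod>e\<in>A. measure_pmf.prob (bernoulli_pmf p) (B e))"
    by (rule measure_Pi_pmf_Pi) fact
  also have "\<dots> = (\<Prod>e\<in>A. (if e \<in> Y then p else 1) * (if e \<in> N then 1 - p else 1))"
    using assms(4-6) by (intro prod.cong refl) (auto simp: B_def measure_pmf_single)
  also have "\<dots> = (\<Prod>e\<in>A. if e \<in> Y then p else 1) * (\<Prod>e\<in>A. if e \<in> N then 1 - p else 1)"
    by (rule prod.distrib)
  also have "(\<Prod>e\<in>A. if e \<in> Y then p else 1) = p ^ card Y"
    using assms(1,2) by (simp add: prod.If_cases Int_absorb1)
  also have "(\<Prod>e\<in>A. if e \<in> N then 1 - p else 1) = (1 - p) ^ card N"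
    using assms(1,3) by (simp add: prod.If_cases Int_absorb1)
  finally show ?thesis by (simp add: eq)
qed

text \<open>\<open>F\<close> is the set of pairs exposed first: \<open>f\<close> records their
  outcome and is fixed by conditioning, while \<open>g\<close> stays random on the remaining
  pairs.\<close>

definition merged_graph :: "'a set \<Rightarrow> 'a set set \<Rightarrow> ('a set \<Rightarrow> bool) \<Rightarrow> ('a set \<Rightarrow> bool) \<Rightarrow> 'a set set" where
  "merged_graph V F f g = {e \<in> all_edges V. if e \<in> F then f e else g e}"

text \<open>Crossing edges inside \<open>F\<close> are already present and cost nothing; what
  remains is one factor \<open>p\<close> per unexposed crossing edge and \<open>1 - p\<close> for
  each of the two diagonals, which are unexposed and distinct.\<close>

lemma prob_C4_pair:
  assumes V: "finite V" and PR: "(P, R) \<in> disjoint_pairs V" and F: "P \<notin> F" "R \<notin> F"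
    and cr: "crossing P R \<inter> F \<subseteq> Collect f" and p: "0 \<le> p" "p \<le> (1::real)"
  shows "measure_pmf.prob (Pi_pmf (all_edges V - F) False (\<lambda>_. bernoulli_pmf p))
           {g. C4_pair (merged_graph V F f g) P R} = p ^ card (crossing P R - F) * (1 - p)\<^sup>2"
proof -
  have P: "P \<subseteq> V" "card P = 2" and R: "R \<subseteq> V" "card R = 2" and dis: "P \<inter> R = {}"
    using PR by (auto simp: disjoint_pairs_def all_edges_def)
  have ne: "P \<noteq> {}" "R \<noteq> {}" using P R by auto
  have sub: "crossing P R \<subseteq> all_edges V"
    using P R dis by (intro crossing_subset_all_edges)
  have nin: "P \<notin> crossing P R" "R \<notin> crossing P R"
    using dis by (auto simp: crossing_def)
  have PRe: "P \<in> all_edges V" "R \<in> all_edges V" using P R by (auto simp: all_edges_def)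
  have pair: "C4_pair (merged_graph V F f g) P R \<longleftrightarrow>
      (\<forall>e\<in>crossing P R - F. g e) \<and> (\<forall>e\<in>{P, R}. \<not> g e)" for g
  proof -
    have mem: "e \<in> merged_graph V F f g \<longleftrightarrow> (if e \<in> F then f e else g e)"
      if "e \<in> all_edges V" for e
      using that by (simp add: merged_graph_def)
    have "crossing P R \<subseteq> merged_graph V F f g \<longleftrightarrow> (\<forall>e\<in>crossing P R. if e \<in> F then f e else g e)"
      using mem sub by blast
    also have "\<dots> \<longleftrightarrow> (\<forall>e\<in>crossing P R - F. g e)"
      using cr by auto
    finally show ?thesis
      using F PRe by (auto simp: C4_pair_def mem)
  qed
  have "card {P, R} = 2" using dis ne by (cases "P = R") auto
  then show ?thesis
    unfolding pair using prob_edge_pattern[of "all_edges V - F" "crossing P R - F" "{P, R}" p]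
      V sub PRe F nin p by (simp add: Diff_mono)
qed

section \<open>Expected counts and the reverse Markov inequality\<close>

lemma integrable_bounded_pmf:
  fixes X :: "'a \<Rightarrow> real"
  assumes "\<And>x. 0 \<le> X x" "\<And>x. X x \<le> b"
  shows "integrable (measure_pmf M) X"
  by (rule measure_pmf.integrable_const_bound[of _ b]) (use assms in auto)

text \<open>Take expectations in the pointwise bound of \<open>X\<close> by \<open>K\<close> plus
  \<open>b\<close> times the indicator of \<open>K \<le> X\<close>.\<close>

lemma reverse_Markov_pmf:
  fixes X :: "'a \<Rightarrow> real"
  assumes "\<And>x. 0 \<le> X x" "\<And>x. X x \<le> b" "0 < b" "0 \<le> K"
  shows "(measure_pmf.expectation M X - K) / b \<le> measure_pmf.prob M {x. K \<le> X x}"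
proof -
  have "measure_pmf.expectation M X \<le>
      measure_pmf.expectation M (\<lambda>x. K + b * indicator {x. K \<le> X x} x)"
  proof (rule integral_mono)
    show "integrable (measure_pmf M) X" by (rule integrable_bounded_pmf) fact+
    show "X x \<le> K + b * indicator {x. K \<le> X x} x" for x
      using assms(2)[of x] assms(4) by (auto simp: indicator_def)
    show "integrable (measure_pmf M) (\<lambda>x. K + b * indicator {x. K \<le> X x} x)"
      using assms(3,4) by (intro integrable_bounded_pmf[of _ "K + b"]) (auto simp: indicator_def)
  qed
  also have "\<dots> = K + b * measure_pmf.prob M {x. K \<le> X x}"
  proof -
    have "integrable (measure_pmf M) (\<lambda>x. b * indicator {x. K \<le> X x} x)"
      using assms(3) by (intro integrable_bounded_pmf[of _ b]) (auto simp: indicator_def)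
    then show ?thesis
      by (subst Bochner_Integration.integral_add) auto
  qed
  finally show ?thesis using assms(3) by (simp add: field_simps)
qed

lemma num_induced_C4_eq_sum:
  assumes "E \<subseteq> all_edges {1..n}"
  shows "real (num_induced_C4 n E) =
    (\<Sum>(P, R)\<in>disjoint_pairs {1..n}. indicator {E. C4_pair E P R} E) / 2"
proof -
  have "2 * real (num_induced_C4 n E) = real (card {(P, R) \<in> disjoint_pairs {1..n}. C4_pair E P R})"
    using num_induced_C4_pairs[OF assms] by (metis of_nat_mult of_nat_numeral)
  also have "{(P, R) \<in> disjoint_pairs {1..n}. C4_pair E P R}
      = disjoint_pairs {1..n} \<inter> {(P, R). C4_pair E P R}" by auto
  also have "real (card \<dots>) = (\<Sum>q\<in>disjoint_pairs {1..n}. if q \<in> {(P, R). C4_pair E P R} then 1 else 0)"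
    by (subst sum.If_cases) auto
  also have "\<dots> = (\<Sum>(P, R)\<in>disjoint_pairs {1..n}. indicator {E. C4_pair E P R} E)"
    by (intro sum.cong) auto
  finally show ?thesis by simp
qed

text \<open>The cap \<open>b\<close> for the reverse Markov inequality. Since \<open>E[X]\<close>
  has order \<open>n^4 p^4\<close>, dividing by it leaves only a loss of order
  \<open>p^4\<close>.\<close>

lemma num_induced_C4_le:
  assumes "E \<subseteq> all_edges {1..n}"
  shows "real (num_induced_C4 n E) \<le> real n ^ 4"
proof -
  have "2 * num_induced_C4 n E \<le> card (disjoint_pairs {1..n})"
    unfolding num_induced_C4_pairs[OF assms] by (intro card_mono) auto
  also have "\<dots> = (n choose 2) * ((n - 2) choose 2)"
    by (simp add: card_disjoint_pairs)
  also have "\<dots> \<le> n ^ 2 * n ^ 2"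
  proof (rule mult_mono)
    have le: "m choose 2 \<le> m ^ 2" for m :: nat
      using binomial_fact_pow[of m 2] by simp
    show "n choose 2 \<le> n ^ 2" by (rule le)
    show "(n - 2) choose 2 \<le> n ^ 2"
      by (rule order.trans[OF le]) (simp add: power_mono)
  qed auto
  finally have "num_induced_C4 n E \<le> n ^ 4"
    by (simp flip: power_add)
  then show ?thesis by (metis of_nat_le_iff of_nat_power)
qed

lemma expectation_num_induced_C4:
  fixes p :: real
  assumes "0 \<le> p" "p \<le> 1"
  shows "measure_pmf.expectation (Pi_pmf (all_edges {1..n} - F) False (\<lambda>_. bernoulli_pmf p))
           (\<lambda>g. real (num_induced_C4 n (merged_graph {1..n} F f g))) =
         (\<Sum>(P, R)\<in>disjoint_pairs {1..n}.
            measure_pmf.prob (Pi_pmf (all_edges {1..n} - F) False (\<lambda>_. bernoulli_pmf p))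
              {g. C4_pair (merged_graph {1..n} F f g) P R}) / 2"
proof -
  let ?M = "Pi_pmf (all_edges {1..n} - F) False (\<lambda>_. bernoulli_pmf p)"
  let ?G = "merged_graph {1..n} F f"
  have sub: "?G g \<subseteq> all_edges {1..n}" for g by (auto simp: merged_graph_def)
  have ind: "indicator {E. C4_pair E P R} (?G g) = (indicator {g. C4_pair (?G g) P R} g :: real)"
    for P R g by (simp add: indicator_def)
  have "measure_pmf.expectation ?M (\<lambda>g. real (num_induced_C4 n (?G g))) =
      measure_pmf.expectation ?M
        (\<lambda>g. (\<Sum>q\<in>disjoint_pairs {1..n}. indicator {g. C4_pair (?G g) (fst q) (snd q)} g)) / 2"
    unfolding num_induced_C4_eq_sum[OF sub] case_prod_unfold ind by simp
  also have "\<dots> = (\<Sum>q\<in>disjoint_pairs {1..n}.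
      measure_pmf.prob ?M {g. C4_pair (?G g) (fst q) (snd q)}) / 2"
    by (subst Bochner_Integration.integral_sum)
       (auto intro!: integrable_bounded_pmf[of _ 1] simp: indicator_def)
  finally show ?thesis by (simp add: case_prod_beta)
qed

text \<open>The case \<open>F = {}\<close> of the conditional expectation: every pair of diagonals
  has four unexposed crossing edges. The prefactor is 3 times \<open>n choose 4\<close>, halved from
  the count of ordered pairs.\<close>

lemma expected_C4_eq:
  assumes "0 \<le> p" "p \<le> 1"
  shows "expected_C4 n p = real (n choose 2) * real ((n - 2) choose 2) / 2 * p ^ 4 * (1 - p)\<^sup>2"
proof -
  have "expected_C4 n p = measure_pmf.expectation (Pi_pmf (all_edges {1..n} - {}) False (\<lambda>_. bernoulli_pmf p))
           (\<lambda>g. real (num_induced_C4 n (merged_graph {1..n} {} (\<lambda>_. True) g)))"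
    unfolding expected_C4_def binomial_random_graph_def by (simp add: merged_graph_def)
  also have "\<dots> = (\<Sum>q\<in>disjoint_pairs {1..n}. p ^ 4 * (1 - p)\<^sup>2) / 2"
    unfolding expectation_num_induced_C4[OF assms]
  proof (intro arg_cong2[where f = "(/)"] sum.cong refl)
    fix q assume q: "q \<in> disjoint_pairs {1..n}"
    obtain P R where PR: "q = (P, R)" by (cases q)
    have "card (crossing P R) = 4"
      using q PR by (subst card_crossing) (auto simp: disjoint_pairs_def all_edges_def)
    then show "(case q of (P, R) \<Rightarrow>
        measure_pmf.prob (Pi_pmf (all_edges {1..n} - {}) False (\<lambda>_. bernoulli_pmf p))
          {g. C4_pair (merged_graph {1..n} {} (\<lambda>_. True) g) P R}) = p ^ 4 * (1 - p)\<^sup>2"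
      using prob_C4_pair[of "{1..n}" P R "{}" "\<lambda>_. True" p] q assms by (simp add: PR)
  qed
  finally show ?thesis by (simp add: card_disjoint_pairs)
qed

section \<open>Two-round exposure and the planting inequality\<close>

text \<open>Total probability restricted to the good outcomes \<open>G\<close> of the first round.
  The computation is in \<open>ennreal\<close>, where the measure of a bind is an integral.\<close>

lemma prob_bind_pmf_ge:
  assumes "\<And>x. x \<in> G \<Longrightarrow> c \<le> measure_pmf.prob (N x) X" "0 \<le> c"
  shows "measure_pmf.prob M G * c \<le> measure_pmf.prob (bind_pmf M N) X"
proof -
  have "ennreal (measure_pmf.prob M G * c) = (\<integral>\<^sup>+x. ennreal c * indicator G x \<partial>measure_pmf M)"
    using assms(2)
    by (simp add: nn_integral_cmult_indicator ennreal_mult measure_pmf.emeasure_eq_measure mult.commute)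
  also have "\<dots> \<le> (\<integral>\<^sup>+x. emeasure (measure_pmf (N x)) X \<partial>measure_pmf M)"
    using assms(1)
    by (intro nn_integral_mono) (auto simp: indicator_def measure_pmf.emeasure_eq_measure intro!: ennreal_leI)
  also have "\<dots> = ennreal (measure_pmf.prob (bind_pmf M N) X)"
    by (simp flip: measure_pmf.emeasure_eq_measure)
  finally show ?thesis by simp
qed

lemma binomial_random_graph_merged:
  assumes "F \<subseteq> all_edges {1..n}"
  shows "binomial_random_graph n p =
    bind_pmf (Pi_pmf F False (\<lambda>_. bernoulli_pmf p)) (\<lambda>f.
      map_pmf (merged_graph {1..n} F f) (Pi_pmf (all_edges {1..n} - F) False (\<lambda>_. bernoulli_pmf p)))"
proof -
  have fin: "finite F" using assms by (rule finite_subset) simp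
  have pair: "pair_pmf M N = bind_pmf M (\<lambda>f. map_pmf (Pair f) N)"
    for M N :: "(nat set \<Rightarrow> bool) pmf"
    by (simp add: pair_pmf_def map_pmf_def)
  have eq: "all_edges {1..n} = F \<union> (all_edges {1..n} - F)" using assms by auto
  have "Pi_pmf (all_edges {1..n}) False (\<lambda>_. bernoulli_pmf p) =
     map_pmf (\<lambda>(f,g) x. if x \<in> F then f x else g x)
       (pair_pmf (Pi_pmf F False (\<lambda>_. bernoulli_pmf p))
         (Pi_pmf (all_edges {1..n} - F) False (\<lambda>_. bernoulli_pmf p)))"
    by (subst eq, rule Pi_pmf_union) (use fin in auto)
  then show ?thesis
    unfolding binomial_random_graph_def pair
    by (simp add: map_bind_pmf map_pmf_comp merged_graph_def[abs_def])
qed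

text \<open>\<open>G\<close> is the planted event on the exposed pairs \<open>F\<close>,
  \<open>K\<close> the tail threshold and \<open>L\<close> a lower bound for the conditional
  expectation given any outcome in \<open>G\<close>. The family \<open>\<Phi>\<close>, which may
  depend on the outcome, witnesses this bound; the factor 2 accounts for ordered pairs. Reverse
  Markov then bounds the conditional tail probability.\<close>

lemma upper_tail_planting:
  fixes p K L :: real
  assumes p: "0 \<le> p" "p \<le> 1" and F: "F \<subseteq> all_edges {1..n}" and n: "n \<ge> 1" and KL: "0 \<le> K" "K \<le> L"
    and good: "\<And>f. f \<in> G \<Longrightarrow> \<exists>\<Phi>. \<Phi> \<subseteq> disjoint_pairs {1..n} \<and>
      (\<forall>(P, R)\<in>\<Phi>. P \<notin> F \<and> R \<notin> F \<and> crossing P R \<inter> F \<subseteq> Collect f) \<and>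
      2 * L \<le> (\<Sum>(P, R)\<in>\<Phi>. p ^ card (crossing P R - F)) * (1 - p)\<^sup>2"
  shows "measure_pmf.prob (Pi_pmf F False (\<lambda>_. bernoulli_pmf p)) G * ((L - K) / real n ^ 4)
    \<le> measure_pmf.prob (binomial_random_graph n p) {E. K \<le> real (num_induced_C4 n E)}"
  unfolding binomial_random_graph_merged[OF F]
proof (rule prob_bind_pmf_ge)
  show "0 \<le> (L - K) / real n ^ 4" using KL by simp
  fix f assume "f \<in> G"
  then obtain \<Phi> where \<Phi>: "\<Phi> \<subseteq> disjoint_pairs {1..n}"
      "\<forall>(P, R)\<in>\<Phi>. P \<notin> F \<and> R \<notin> F \<and> crossing P R \<inter> F \<subseteq> Collect f"
      "2 * L \<le> (\<Sum>(P, R)\<in>\<Phi>. p ^ card (crossing P R - F)) * (1 - p)\<^sup>2"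
    using good by meson
  let ?M = "Pi_pmf (all_edges {1..n} - F) False (\<lambda>_. bernoulli_pmf p)"
  let ?G = "merged_graph {1..n} F f"
  have sub: "?G g \<subseteq> all_edges {1..n}" for g by (auto simp: merged_graph_def)
  have "2 * L \<le> (\<Sum>(P, R)\<in>\<Phi>. p ^ card (crossing P R - F) * (1 - p)\<^sup>2)"
    using \<Phi>(3) by (simp add: sum_distrib_right case_prod_beta)
  also have "\<dots> = (\<Sum>(P, R)\<in>\<Phi>. measure_pmf.prob ?M {g. C4_pair (?G g) P R})"
  proof (intro sum.cong refl, clarify)
    fix P R assume q: "(P, R) \<in> \<Phi>"
    then have "P \<notin> F" "R \<notin> F" "crossing P R \<inter> F \<subseteq> Collect f"
      using \<Phi>(2) by auto
    then show "p ^ card (crossing P R - F) * (1 - p)\<^sup>2 = measure_pmf.prob ?M {g. C4_pair (?G g) P R}"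
      using q \<Phi>(1) p by (subst prob_C4_pair) auto
  qed
  \<comment> \<open>Pairs outside \<open>\<Phi>\<close> contribute nonnegative probabilities and may
    be added.\<close>
  also have "\<dots> \<le> (\<Sum>(P, R)\<in>disjoint_pairs {1..n}. measure_pmf.prob ?M {g. C4_pair (?G g) P R})"
    using \<Phi>(1) by (intro sum_mono2) auto
  also have "\<dots> = 2 * measure_pmf.expectation ?M (\<lambda>g. real (num_induced_C4 n (?G g)))"
    by (subst expectation_num_induced_C4[OF p]) simp
  finally have "(L - K) / real n ^ 4 \<le>
      (measure_pmf.expectation ?M (\<lambda>g. real (num_induced_C4 n (?G g))) - K) / real n ^ 4"
    by (intro divide_right_mono) auto
  also have "\<dots> \<le> measure_pmf.prob ?M {g. K \<le> real (num_induced_C4 n (?G g))}"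
    using n KL by (intro reverse_Markov_pmf num_induced_C4_le[OF sub]) auto
  finally show "(L - K) / real n ^ 4 \<le>
      measure_pmf.prob (map_pmf ?G ?M) {E. K \<le> real (num_induced_C4 n E)}"
    by (simp add: vimage_def)
qed

subsection \<open>Planting a complete bipartite graph\<close>

text \<open>Three kinds of copies: diagonals in \<open>S\<close> and \<open>T\<close> (weight 1),
  one diagonal in \<open>T\<close> and the other with one vertex in \<open>S\<close> and one outside
  \<open>S \<union> T\<close> (weight \<open>p^2\<close>), and copies avoiding \<open>S\<close>
  (weight at least \<open>p^4\<close>). Swapping doubles the first two kinds; the third is counted
  with both orders at once, hence its \<open>/ 2\<close>. Leaving \<open>F\<close> free between
  \<open>crossing S T\<close> and \<open>crossing S (V - S)\<close> serves both ranges of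
  \<open>p\<close>.\<close>

lemma planted_pairs:
  fixes p :: real
  assumes V: "finite V" and S: "S \<subseteq> V" and T: "T \<subseteq> V - S"
    and F: "F \<subseteq> crossing S (V - S)" "crossing S T \<subseteq> F" and f: "crossing S T \<subseteq> Collect f"
    and p: "0 \<le> p" "p \<le> 1"
  shows "\<exists>\<Phi>. \<Phi> \<subseteq> disjoint_pairs V \<and>
    (\<forall>(P, R)\<in>\<Phi>. P \<notin> F \<and> R \<notin> F \<and> crossing P R \<inter> F \<subseteq> Collect f) \<and>
    2 * (real (card S choose 2) * real (card T choose 2)
         + real (card (crossing S (V - S - T) - F)) * real (card T choose 2) * p\<^sup>2
         + real (card (V - S) choose 2) * real ((card (V - S) - 2) choose 2) / 2 * p ^ 4)
      \<le> (\<Sum>(P, R)\<in>\<Phi>. p ^ card (crossing P R - F))"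
proof -
  define W where "W = V - S - T"
  \<comment> \<open>Mixed diagonals must avoid \<open>F\<close>, so that they can still be absent;
    \<open>H\<close> is empty when all pairs leaving \<open>S\<close> are exposed.\<close>
  define H where "H = crossing S W - F"
  define M where "M = (all_edges S \<union> H) \<times> all_edges T"
  define M' where "M' = prod.swap ` M"
  define D where "D = disjoint_pairs (V - S)"
  define w where "w = (\<lambda>q. p ^ card (crossing (fst q) (snd q) - F))"
  have fin: "finite S" "finite T" "finite W"
    using V S T by (auto simp: W_def intro: finite_subset)
  have finH: "finite H" using fin by (simp add: H_def)
  \<comment> \<open>Every exposed pair has exactly one end in \<open>S\<close>, so no diagonal lying
    inside \<open>S\<close> or outside \<open>S\<close> has been exposed.\<close>
  have FS: "e \<inter> S \<noteq> {}" "e - S \<noteq> {}" if "e \<in> F" for e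
    using that F(1) by (auto simp: crossing_def)
  have H: "\<exists>v\<in>S. \<exists>u\<in>W. e = {v, u}" if "e \<in> H" for e
    using that by (auto simp: H_def crossing_def)
  have SW: "S \<inter> W = {}" "S \<inter> T = {}" "W \<inter> T = {}" using T by (auto simp: W_def)
  have finM: "finite M" using fin finH by (auto simp: M_def)
  have finM': "finite M'" using finM by (simp add: M'_def)
  have finD: "finite D" using V by (simp add: D_def)
  have M_pairs: "(P, R) \<in> disjoint_pairs V \<and> P \<inter> S \<noteq> {} \<and> R \<inter> S = {} \<and> P \<notin> F \<and> R \<notin> F
      \<and> crossing P R \<inter> F \<subseteq> Collect f" if "(P, R) \<in> M" for P R
  proof -
    have R: "R \<subseteq> T" "card R = 2" using that by (auto simp: M_def all_edges_def)
    then have RS: "R \<inter> S = {}" using SW by auto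
    \<comment> \<open>\<open>R\<close> avoids \<open>S\<close>, so the end in \<open>S\<close> of an
      exposed crossing edge comes from \<open>P\<close>, and its other end lies in
      \<open>R \<subseteq> T\<close>: the edge is planted.\<close>
    have cr: "crossing P R \<inter> F \<subseteq> crossing S T"
    proof
      fix e assume e: "e \<in> crossing P R \<inter> F"
      then obtain x y where xy: "e = {x, y}" "x \<in> P" "y \<in> R" by (auto simp: crossing_def)
      then have "x \<in> S" using FS(1)[of e] e RS by auto
      then show "e \<in> crossing S T" using xy R(1) by (auto simp: crossing_def)
    qed
    have P: "P \<subseteq> V \<and> card P = 2 \<and> P \<inter> R = {} \<and> P \<inter> S \<noteq> {} \<and> P \<notin> F"
    proof (cases "P \<in> all_edges S")
      case True
      then have "P \<subseteq> S" "card P = 2" by (auto simp: all_edges_def)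
      moreover from this have "P \<noteq> {}" by auto
      ultimately show ?thesis using S RS FS(2)[of P] by auto
    next
      case False
      then have "P \<in> H" using that by (auto simp: M_def)
      then obtain v u where "v \<in> S" "u \<in> W" "P = {v, u}" using H by blast
      moreover have "W \<subseteq> V" "R \<inter> W = {}" using R SW by (auto simp: W_def)
      ultimately show ?thesis
        using S RS SW \<open>P \<in> H\<close> by (auto simp: H_def card_insert_if)
    qed
    have "R \<notin> F" using FS(1)[of R] RS by auto
    moreover have "R \<subseteq> V" using R T by auto
    ultimately show ?thesis
      using P R RS cr f by (auto simp: disjoint_pairs_def all_edges_def)
  qed
  have M'_pairs: "(P, R) \<in> disjoint_pairs V \<and> R \<inter> S \<noteq> {} \<and> P \<inter> S = {} \<and> P \<notin> F \<and> R \<notin> F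
      \<and> crossing P R \<inter> F \<subseteq> Collect f" if "(P, R) \<in> M'" for P R
    using M_pairs[of R P] that
    by (auto simp: M'_def disjoint_pairs_def all_edges_def crossing_commute)
  have D_pairs: "(P, R) \<in> disjoint_pairs V \<and> R \<inter> S = {} \<and> P \<inter> S = {} \<and> P \<notin> F \<and> R \<notin> F
      \<and> crossing P R \<inter> F \<subseteq> Collect f" if "(P, R) \<in> D" for P R
  proof -
    have PR: "P \<subseteq> V - S" "R \<subseteq> V - S" "(P, R) \<in> disjoint_pairs V"
      using that by (auto simp: D_def disjoint_pairs_def all_edges_def)
    have "crossing P R \<inter> F = {}"
    proof (rule ccontr)
      assume "\<not> ?thesis"
      then obtain e where "e \<in> crossing P R" "e \<in> F" by auto
      then show False using FS(1)[of e] PR by (auto simp: crossing_def)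
    qed
    then show ?thesis using PR FS(1)[of P] FS(1)[of R] by auto
  qed
  have w_mono: "p ^ j \<le> w (P, R)" if "card (crossing P R - F) \<le> j" for P R j
    unfolding w_def using that p by (simp add: power_decreasing)
  have finTE: "finite (all_edges T)" using fin by simp
  have "real (card S choose 2) * real (card T choose 2)
         + real (card H) * real (card T choose 2) * p\<^sup>2 \<le> sum w M"
  proof -
    have "sum w M = sum w (all_edges S \<times> all_edges T) + sum w (H \<times> all_edges T)"
      unfolding M_def Sigma_Un_distrib1
    proof (rule sum.union_disjoint)
      have "all_edges S \<inter> H = {}" using H SW(1) by (fastforce simp: all_edges_def)
      then show "all_edges S \<times> all_edges T \<inter> H \<times> all_edges T = {}" by auto
    qed (use fin finH in auto)
    moreover have "real (card (all_edges S \<times> all_edges T)) * 1 \<le> sum w (all_edges S \<times> all_edges T)"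
    proof (rule sum_bounded_below)
      fix q assume "q \<in> all_edges S \<times> all_edges T"
      then have "crossing (fst q) (snd q) \<subseteq> F"
        using crossing_mono[of "fst q" S "snd q" T, THEN order.trans, OF _ _ F(2)]
        by (auto simp: all_edges_def)
      then have eq: "crossing (fst q) (snd q) - F = {}" by auto
      show "1 \<le> w q" unfolding w_def eq by simp
    qed
    moreover have "real (card (H \<times> all_edges T)) * p\<^sup>2 \<le> sum w (H \<times> all_edges T)"
    proof (rule sum_bounded_below)
      fix q assume q: "q \<in> H \<times> all_edges T"
      then have "fst q \<in> H" by auto
      from H[OF this] obtain v u where vu: "v \<in> S" "u \<in> W" "fst q = {v, u}" by blast
      have R: "snd q \<subseteq> T" "card (snd q) = 2" using q by (auto simp: all_edges_def)
      \<comment> \<open>The two crossing edges at the end \<open>v\<close> in \<open>S\<close> are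
        planted; only the two at \<open>u\<close> remain, which gives the weight
        \<open>p^2\<close>.\<close>
      have "crossing (fst q) (snd q) - F \<subseteq> crossing {u} (snd q)"
      proof -
        have "{v, b} \<in> crossing S T" if "b \<in> snd q" for b
          using vu(1) R(1) that by (force simp: crossing_def)
        then have "{v, b} \<in> F" if "b \<in> snd q" for b
          using F(2) that by blast
        then show ?thesis using vu(3) by (auto simp: crossing_def)
      qed
      moreover have "finite (snd q)" using R(2) by (auto intro: card_ge_0_finite)
      ultimately have "card (crossing (fst q) (snd q) - F) \<le> card (crossing {u} (snd q))"
        by (intro card_mono) auto
      also have "\<dots> = 2"
        using R vu SW by (subst card_crossing) auto
      finally show "p\<^sup>2 \<le> w q" using w_mono[of "fst q" "snd q" 2] by simp
    qed
    ultimately show ?thesis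
      using fin by (simp add: card_cartesian_product card_all_edges)
  qed
  moreover have "sum w M' = sum w M"
    unfolding M'_def
    by (subst sum.reindex) (auto simp: w_def o_def crossing_commute intro!: sum.cong)
  moreover have "real (card D) * p ^ 4 \<le> sum w D"
  proof (rule sum_bounded_below)
    fix q assume q: "q \<in> D"
    have "finite (fst q)" "finite (snd q)"
      using q by (auto simp: D_def disjoint_pairs_def all_edges_def intro!: card_ge_0_finite)
    then have "card (crossing (fst q) (snd q) - F) \<le> card (crossing (fst q) (snd q))"
      by (intro card_mono) auto
    also have "\<dots> = 4"
      using q by (subst card_crossing) (auto simp: D_def disjoint_pairs_def all_edges_def)
    finally show "p ^ 4 \<le> w q" using w_mono[of "fst q" "snd q" 4] by simp
  qed
  moreover have "sum w (M \<union> M' \<union> D) = sum w M + sum w M' + sum w D"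
  proof -
    \<comment> \<open>The families differ in which component meets \<open>S\<close>: only the first,
      only the second, or neither.\<close>
    have "M \<inter> M' = {}" "(M \<union> M') \<inter> D = {}"
      using M_pairs M'_pairs D_pairs by fast+
    then show ?thesis using finM finM' finD by (simp add: sum.union_disjoint)
  qed
  moreover have "card D = (card (V - S) choose 2) * ((card (V - S) - 2) choose 2)"
    unfolding D_def using V by (subst card_disjoint_pairs) auto
  ultimately have "2 * (real (card S choose 2) * real (card T choose 2)
         + real (card H) * real (card T choose 2) * p\<^sup>2
         + real (card (V - S) choose 2) * real ((card (V - S) - 2) choose 2) / 2 * p ^ 4)
      \<le> sum w (M \<union> M' \<union> D)"
    by (simp add: algebra_simps)
  then have "2 * (real (card S choose 2) * real (card T choose 2)
         + real (card (crossing S (V - S - T) - F)) * real (card T choose 2) * p\<^sup>2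
         + real (card (V - S) choose 2) * real ((card (V - S) - 2) choose 2) / 2 * p ^ 4)
      \<le> (\<Sum>(P, R)\<in>M \<union> M' \<union> D. p ^ card (crossing P R - F))"
    unfolding w_def H_def W_def by (simp add: case_prod_unfold)
  moreover have "\<forall>(P, R)\<in>M \<union> M' \<union> D. P \<notin> F \<and> R \<notin> F \<and> crossing P R \<inter> F \<subseteq> Collect f"
    using M_pairs M'_pairs D_pairs by blast
  moreover have "M \<union> M' \<union> D \<subseteq> disjoint_pairs V"
  proof
    fix q assume "q \<in> M \<union> M' \<union> D"
    then show "q \<in> disjoint_pairs V"
      using M_pairs[of "fst q" "snd q"] M'_pairs[of "fst q" "snd q"] D_pairs[of "fst q" "snd q"]
      by auto
  qed
  ultimately show ?thesis by blast
qed

section \<open>Probability and effect of the planted edges\<close>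

lemma prob_crossing_present:
  assumes "finite F" "crossing S T \<subseteq> F" "S \<inter> T = {}" "0 \<le> p" "p \<le> (1::real)"
  shows "measure_pmf.prob (Pi_pmf F False (\<lambda>_. bernoulli_pmf p)) {f. crossing S T \<subseteq> Collect f}
    = p ^ (card S * card T)"
proof -
  have "{f. crossing S T \<subseteq> Collect f} = {f. (\<forall>e\<in>crossing S T. f e) \<and> (\<forall>e\<in>{}. \<not> f e)}" by auto
  then show ?thesis
    using prob_edge_pattern[of F "crossing S T" "{}" p] assms by (simp add: card_crossing)
qed

text \<open>The events that all of \<open>T\<close> is joined to \<open>S\<close> overlap for
  different \<open>T\<close>. Requiring the common neighbourhood to be exactly \<open>T\<close>
  makes them disjoint, so their probabilities add up, and a union bound over one extra vertex shows
  that each loses only the factor \<open>1 - |V| p^|S|\<close>.\<close>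

lemma prob_common_neighbours:
  fixes p :: real
  assumes V: "finite V" and S: "S \<subseteq> V" and p: "0 \<le> p" "p \<le> 1"
  shows "real (card (V - S) choose t) * p ^ (card S * t) * (1 - real (card V) * p ^ card S)
    \<le> measure_pmf.prob (Pi_pmf (crossing S (V - S)) False (\<lambda>_. bernoulli_pmf p))
        {f. \<exists>T. T \<subseteq> V - S \<and> card T = t \<and> crossing S T \<subseteq> Collect f}"
proof -
  let ?M = "Pi_pmf (crossing S (V - S)) False (\<lambda>_. bernoulli_pmf p)"
  define A where "A = (\<lambda>T. {f. crossing S T \<subseteq> Collect f})"
  \<comment> \<open>\<open>B T\<close> says that the common neighbourhood of \<open>S\<close> in
    \<open>V - S\<close> equals \<open>T\<close>: no further vertex is joined to all of
    \<open>S\<close>.\<close>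
  define B where "B = (\<lambda>T. A T - (\<Union>v\<in>V - S - T. A (insert v T)))"
  define \<T> where "\<T> = {T. T \<subseteq> V - S \<and> card T = t}"
  have finS: "finite S" using V S by (rule finite_subset[rotated])
  have finF: "finite (crossing S (V - S))" using V finS by simp
  have fin\<T>: "finite \<T>" unfolding \<T>_def using V by (auto intro: rev_finite_subset[of "Pow V"])
  have probA: "measure_pmf.prob ?M (A T) = p ^ (card S * card T)" if "T \<subseteq> V - S" for T
    unfolding A_def using that finF p
    by (intro prob_crossing_present crossing_mono) auto
  have B_ge: "p ^ (card S * t) * (1 - real (card V) * p ^ card S) \<le> measure_pmf.prob ?M (B T)"
    if T: "T \<in> \<T>" for T
  proof -
    have T': "T \<subseteq> V - S" "card T = t" "finite T" using T V by (auto simp: \<T>_def intro: finite_subset)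
    have "measure_pmf.prob ?M (A T) \<le>
        measure_pmf.prob ?M (B T \<union> (\<Union>v\<in>V - S - T. A (insert v T)))"
      by (intro measure_pmf.finite_measure_mono) (auto simp: B_def)
    also have "\<dots> \<le> measure_pmf.prob ?M (B T) + measure_pmf.prob ?M (\<Union>v\<in>V - S - T. A (insert v T))"
      by (intro measure_Un_le) auto
    also have "measure_pmf.prob ?M (\<Union>v\<in>V - S - T. A (insert v T))
        \<le> (\<Sum>v\<in>V - S - T. measure_pmf.prob ?M (A (insert v T)))"
      using V by (intro measure_pmf.finite_measure_subadditive_finite) auto
    also have "\<dots> = (\<Sum>v\<in>V - S - T. p ^ (card S * t + card S))"
    proof (intro sum.cong refl)
      fix v assume v: "v \<in> V - S - T"
      then have "card (insert v T) = t + 1" using T' by simp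
      then show "measure_pmf.prob ?M (A (insert v T)) = p ^ (card S * t + card S)"
        using probA[of "insert v T"] v T' by (simp add: add.commute)
    qed
    also have "\<dots> \<le> real (card V) * p ^ (card S * t + card S)"
    proof -
      have "card (V - S - T) \<le> card V" using V by (intro card_mono) auto
      then show ?thesis using p by (simp add: mult_right_mono)
    qed
    finally show ?thesis
      using probA[OF T'(1)] T'(2) by (simp add: algebra_simps power_add)
  qed
  have disj: "disjoint_family_on B \<T>"
    unfolding disjoint_family_on_def
  proof (intro ballI impI)
    fix T T' assume T: "T \<in> \<T>" "T' \<in> \<T>" "T \<noteq> T'"
    have "finite T" "finite T'" using T V by (auto simp: \<T>_def intro: finite_subset)
    then have "\<not> T' \<subseteq> T" using T card_subset_eq[of T T'] by (auto simp: \<T>_def)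
    then obtain v where v: "v \<in> T'" "v \<notin> T" by auto
    \<comment> \<open>If \<open>T\<close> and \<open>T'\<close> were both common neighbourhoods,
      \<open>v\<close> would extend \<open>T\<close>, which \<open>B T\<close> forbids.\<close>
    have "f \<in> A (insert v T)" if "f \<in> A T" "f \<in> A T'" for f
      using that v by (auto simp: A_def crossing_def)
    moreover have "v \<in> V - S - T" using v T by (auto simp: \<T>_def)
    ultimately show "B T \<inter> B T' = {}" by (auto simp: B_def)
  qed
  have "real (card \<T>) * (p ^ (card S * t) * (1 - real (card V) * p ^ card S))
      \<le> (\<Sum>T\<in>\<T>. measure_pmf.prob ?M (B T))"
    using B_ge by (intro sum_bounded_below)
  also have "\<dots> = measure_pmf.prob ?M (\<Union>T\<in>\<T>. B T)"
    using fin\<T> disj by (intro measure_pmf.finite_measure_finite_Union[symmetric]) auto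
  also have "\<dots> \<le> measure_pmf.prob ?M
      {f. \<exists>T. T \<subseteq> V - S \<and> card T = t \<and> crossing S T \<subseteq> Collect f}"
    by (intro measure_pmf.finite_measure_mono) (auto simp: B_def A_def \<T>_def)
  also have "card \<T> = card (V - S) choose t"
    unfolding \<T>_def using V by (intro n_subsets) auto
  finally show ?thesis by (simp add: mult.assoc)
qed

text \<open>All pairs leaving \<open>{1..k}\<close> are exposed, so \<open>T\<close> may depend on
  the outcome; this keeps the factor counting the choices of \<open>T\<close>. There are then no
  mixed diagonals, hence no \<open>p^2\<close> term in \<open>L\<close>.\<close>

lemma upper_tail_planted_common_neighbours:
  fixes p K L :: real
  assumes p: "0 \<le> p" "p \<le> 1" and k: "k \<le> n" and n: "1 \<le> n" and K: "0 \<le> K"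
    and L: "L = (real (k choose 2) * real (t choose 2)
      + real ((n - k) choose 2) * real ((n - k - 2) choose 2) / 2 * p ^ 4) * (1 - p)\<^sup>2" "K \<le> L"
  shows "real ((n - k) choose t) * p ^ (k * t) * (1 - real n * p ^ k) * ((L - K) / real n ^ 4)
    \<le> measure_pmf.prob (binomial_random_graph n p) {E. K \<le> real (num_induced_C4 n E)}"
proof -
  let ?V = "{1..n}" and ?S = "{1..k}"
  let ?F = "crossing ?S (?V - ?S)"
  let ?G = "{f. \<exists>T. T \<subseteq> ?V - ?S \<and> card T = t \<and> crossing ?S T \<subseteq> Collect f}"
  have S: "?S \<subseteq> ?V" "card (?V - ?S) = n - k" using k by (auto simp: card_Diff_subset)
  have "real ((n - k) choose t) * p ^ (k * t) * (1 - real n * p ^ k) * ((L - K) / real n ^ 4)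
      \<le> measure_pmf.prob (Pi_pmf ?F False (\<lambda>_. bernoulli_pmf p)) ?G * ((L - K) / real n ^ 4)"
    using prob_common_neighbours[of ?V ?S p t] S p L(2) by (intro mult_right_mono) auto
  also have "\<dots> \<le> measure_pmf.prob (binomial_random_graph n p) {E. K \<le> real (num_induced_C4 n E)}"
  proof (rule upper_tail_planting[OF p _ n K L(2)])
    show "?F \<subseteq> all_edges ?V" using S by (intro crossing_subset_all_edges) auto
  next
    fix f assume "f \<in> ?G"
    then obtain T where T: "T \<subseteq> ?V - ?S" "card T = t" "crossing ?S T \<subseteq> Collect f" by blast
    have "crossing ?S T \<subseteq> ?F" using T by (intro crossing_mono) auto
    from planted_pairs[OF finite_atLeastAtMost S(1) T(1) order.refl this T(3) p]
    obtain \<Phi> where \<Phi>: "\<Phi> \<subseteq> disjoint_pairs ?V"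
        "\<forall>(P, R)\<in>\<Phi>. P \<notin> ?F \<and> R \<notin> ?F \<and> crossing P R \<inter> ?F \<subseteq> Collect f"
      and le: "2 * (real (card ?S choose 2) * real (card T choose 2)
         + real (card (crossing ?S (?V - ?S - T) - ?F)) * real (card T choose 2) * p\<^sup>2
         + real (card (?V - ?S) choose 2) * real ((card (?V - ?S) - 2) choose 2) / 2 * p ^ 4)
      \<le> (\<Sum>(P, R)\<in>\<Phi>. p ^ card (crossing P R - ?F))" by blast
    have "2 * (real (k choose 2) * real (t choose 2)
      + real ((n - k) choose 2) * real ((n - k - 2) choose 2) / 2 * p ^ 4)
      \<le> 2 * (real (card ?S choose 2) * real (card T choose 2)
         + real (card (crossing ?S (?V - ?S - T) - ?F)) * real (card T choose 2) * p\<^sup>2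
         + real (card (?V - ?S) choose 2) * real ((card (?V - ?S) - 2) choose 2) / 2 * p ^ 4)"
      unfolding S(2) T(2) by simp
    also note le
    finally have "2 * L \<le> (\<Sum>(P, R)\<in>\<Phi>. p ^ card (crossing P R - ?F)) * (1 - p)\<^sup>2"
      unfolding L(1) mult.assoc[symmetric] by (rule mult_right_mono) simp
    with \<Phi> show "\<exists>\<Phi>. \<Phi> \<subseteq> disjoint_pairs {1..n} \<and>
      (\<forall>(P, R)\<in>\<Phi>. P \<notin> ?F \<and> R \<notin> ?F \<and> crossing P R \<inter> ?F \<subseteq> Collect f) \<and>
      2 * L \<le> (\<Sum>(P, R)\<in>\<Phi>. p ^ card (crossing P R - ?F)) * (1 - p)\<^sup>2" by blast
  qed
  finally show ?thesis .
qed

text \<open>Here \<open>T\<close> is fixed and only the pairs between \<open>S\<close> and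
  \<open>T\<close> are exposed, so the pairs from \<open>S\<close> to the other vertices stay free
  to serve as mixed diagonals.\<close>

lemma upper_tail_planted_bipartite:
  fixes p K L :: real
  assumes p: "0 \<le> p" "p \<le> 1" and sh: "s + h \<le> n" and n: "1 \<le> n" and K: "0 \<le> K"
    and L: "L = (real (s choose 2) * real (h choose 2)
      + real (s * (n - s - h)) * real (h choose 2) * p\<^sup>2
      + real ((n - s) choose 2) * real ((n - s - 2) choose 2) / 2 * p ^ 4) * (1 - p)\<^sup>2" "K \<le> L"
  shows "p ^ (s * h) * ((L - K) / real n ^ 4)
    \<le> measure_pmf.prob (binomial_random_graph n p) {E. K \<le> real (num_induced_C4 n E)}"
proof -
  let ?V = "{1..n}" and ?S = "{1..s}" and ?T = "{s+1..s+h}"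
  let ?F = "crossing ?S ?T"
  have S: "?S \<subseteq> ?V" "?T \<subseteq> ?V - ?S" using sh by auto
  have cS: "card (?V - ?S) = n - s" using sh by (subst card_Diff_subset) auto
  have cW: "card (?V - ?S - ?T) = n - s - h" using S cS by (simp add: card_Diff_subset)
  have F: "?F \<subseteq> crossing ?S (?V - ?S)" using S by (intro crossing_mono) auto
  have "p ^ (s * h) = measure_pmf.prob (Pi_pmf ?F False (\<lambda>_. bernoulli_pmf p)) {f. ?F \<subseteq> Collect f}"
    using p by (subst prob_crossing_present) auto
  moreover have "measure_pmf.prob (Pi_pmf ?F False (\<lambda>_. bernoulli_pmf p)) {f. ?F \<subseteq> Collect f}
      * ((L - K) / real n ^ 4)
    \<le> measure_pmf.prob (binomial_random_graph n p) {E. K \<le> real (num_induced_C4 n E)}"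
  proof (rule upper_tail_planting[OF p _ n K L(2)])
    show "?F \<subseteq> all_edges ?V" using sh by (intro crossing_subset_all_edges) auto
  next
    fix f assume "f \<in> {f. ?F \<subseteq> Collect f}"
    then have f: "?F \<subseteq> Collect f" by simp
    from planted_pairs[OF finite_atLeastAtMost S F order.refl this p]
    obtain \<Phi> where \<Phi>: "\<Phi> \<subseteq> disjoint_pairs ?V"
        "\<forall>(P, R)\<in>\<Phi>. P \<notin> ?F \<and> R \<notin> ?F \<and> crossing P R \<inter> ?F \<subseteq> Collect f"
      and le: "2 * (real (card ?S choose 2) * real (card ?T choose 2)
         + real (card (crossing ?S (?V - ?S - ?T) - ?F)) * real (card ?T choose 2) * p\<^sup>2
         + real (card (?V - ?S) choose 2) * real ((card (?V - ?S) - 2) choose 2) / 2 * p ^ 4)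
      \<le> (\<Sum>(P, R)\<in>\<Phi>. p ^ card (crossing P R - ?F))" by blast
    have "crossing ?S (?V - ?S - ?T) \<inter> ?F = {}"
      using S by (auto simp: crossing_def doubleton_eq_iff)
    then have "crossing ?S (?V - ?S - ?T) - ?F = crossing ?S (?V - ?S - ?T)" by auto
    moreover have "?S \<inter> (?V - ?S - ?T) = {}" by auto
    ultimately have cH: "card (crossing ?S (?V - ?S - ?T) - ?F) = s * (n - s - h)"
      by (simp only: card_crossing cW card_atLeastAtMost) simp
    have "2 * L \<le> (\<Sum>(P, R)\<in>\<Phi>. p ^ card (crossing P R - ?F)) * (1 - p)\<^sup>2"
      unfolding L(1) mult.assoc[symmetric]
      using le unfolding cH cS by (intro mult_right_mono) (auto simp: mult.assoc)
    with \<Phi> show "\<exists>\<Phi>. \<Phi> \<subseteq> disjoint_pairs {1..n} \<and>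
      (\<forall>(P, R)\<in>\<Phi>. P \<notin> ?F \<and> R \<notin> ?F \<and> crossing P R \<inter> ?F \<subseteq> Collect f) \<and>
      2 * L \<le> (\<Sum>(P, R)\<in>\<Phi>. p ^ card (crossing P R - ?F)) * (1 - p)\<^sup>2" by blast
  qed
  ultimately show ?thesis by simp
qed

subsection \<open>The two ranges of edge probabilities\<close>

lemma choose_two_real: "real (m choose 2) = real m * (real m - 1) / 2"
  by (induction m) (auto simp: numeral_2_eq_2 field_simps)

lemma expected_C4_polynomial:
  assumes "0 \<le> p" "p \<le> 1" "2 \<le> n"
  shows "expected_C4 n p =
    real n * (real n - 1) * (real n - 2) * (real n - 3) / 8 * p ^ 4 * (1 - p)\<^sup>2"
  using assms by (simp add: expected_C4_eq choose_two_real of_nat_diff)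

lemma expected_C4_bounds:
  assumes p: "0 \<le> p" "p \<le> 1 / 10" and n: "30 \<le> n"
  shows "real n ^ 4 * p ^ 4 / 16 \<le> expected_C4 n p" "expected_C4 n p \<le> real n ^ 4 * p ^ 4 / 8"
proof -
  let ?N = "real n"
  have N: "30 \<le> ?N" using n by simp
  have E: "expected_C4 n p = (?N * (?N - 1) * (?N - 2) * (?N - 3)) * (1 - p)\<^sup>2 * (p ^ 4 / 8)"
    using p n by (simp add: expected_C4_polynomial)
  \<comment> \<open>Each of the four vertex factors is at least \<open>9/10 * n\<close> as
    \<open>n \<ge> 30\<close>; with \<open>(1 - p)^2\<close> this gives
    \<open>(9/10)^6 > 1/2\<close>, hence the constant \<open>1/16\<close>.\<close>
  have "(9/10 * ?N) * (9/10 * ?N) * (9/10 * ?N) * (9/10 * ?N)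
      \<le> ?N * (?N - 1) * (?N - 2) * (?N - 3)"
    using N by (intro mult_mono) auto
  moreover have "(9/10)\<^sup>2 \<le> (1 - p)\<^sup>2" using p by (intro power_mono) auto
  ultimately have lower: "((9/10 * ?N) * (9/10 * ?N) * (9/10 * ?N) * (9/10 * ?N)) * (9/10)\<^sup>2 * (p ^ 4 / 8)
      \<le> expected_C4 n p"
    unfolding E using N p by (intro mult_right_mono mult_mono) auto
  have "?N ^ 4 * (1/2) * (p ^ 4 / 8)
     \<le> ((9/10 * ?N) * (9/10 * ?N) * (9/10 * ?N) * (9/10 * ?N)) * (9/10)\<^sup>2 * (p ^ 4 / 8)"
  proof (rule mult_right_mono)
    have "((9/10 * ?N) * (9/10 * ?N) * (9/10 * ?N) * (9/10 * ?N)) * (9/10)\<^sup>2 = 531441/1000000 * ?N ^ 4"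
      by (simp add: power4_eq_xxxx power2_eq_square)
    then show "?N ^ 4 * (1/2) \<le> ((9/10 * ?N) * (9/10 * ?N) * (9/10 * ?N) * (9/10 * ?N)) * (9/10)\<^sup>2"
      by (simp only:) simp
  qed (use p in simp)
  from order.trans[OF this lower] show "?N ^ 4 * p ^ 4 / 16 \<le> expected_C4 n p" by simp
  have "?N * (?N - 1) * (?N - 2) * (?N - 3) \<le> ?N * ?N * ?N * ?N"
    using N by (intro mult_mono) auto
  moreover have "(1 - p)\<^sup>2 \<le> 1\<^sup>2" using p by (intro power_mono) auto
  ultimately have "expected_C4 n p \<le> ?N * ?N * ?N * ?N * 1\<^sup>2 * (p ^ 4 / 8)"
    unfolding E using N p by (intro mult_right_mono mult_mono) auto
  then show "expected_C4 n p \<le> ?N ^ 4 * p ^ 4 / 8" by (simp add: power4_eq_xxxx)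
qed

text \<open>Deleting \<open>s\<close> vertices costs little: the falling product is at least
  \<open>(n - s - 3)^4\<close>, and Bernoulli's inequality linearises the fourth power of the ratio
  \<open>1 - (s + 3) / n\<close>.\<close>

lemma background_C4_ge:
  assumes p: "0 \<le> p" "p \<le> 1" and n: "2 \<le> n" "s + 3 \<le> n"
  shows "expected_C4 n p * (1 - 4 * (real s + 3) / real n) \<le>
    real ((n - s) choose 2) * real ((n - s - 2) choose 2) / 2 * p ^ 4 * (1 - p)\<^sup>2"
proof -
  let ?N = "real n" and ?w = "p ^ 4 * (1 - p)\<^sup>2 / 8"
  define y where "y = ?N - real s - 3"
  have y: "0 \<le> y" "?N = y + real s + 3" using n by (auto simp: y_def)
  have N: "3 \<le> ?N" using n by simp
  have w: "0 \<le> ?w" using p by simp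
  have E: "expected_C4 n p = ?N * (?N - 1) * (?N - 2) * (?N - 3) * ?w"
    using p n by (simp add: expected_C4_polynomial)
  have E0: "0 \<le> expected_C4 n p" unfolding E using N w by simp
  have "?N * (?N - 1) * (?N - 2) * (?N - 3) \<le> ?N * ?N * ?N * ?N"
    using N by (intro mult_mono) auto
  also have "\<dots> = ?N ^ 4" by (simp add: power4_eq_xxxx)
  finally have E4: "expected_C4 n p \<le> ?N ^ 4 * ?w"
    unfolding E using w by (rule mult_right_mono)
  have "1 - 4 * (real s + 3) / ?N \<le> (1 - (real s + 3) / ?N) ^ 4"
    using Bernoulli_inequality[of "- ((real s + 3) / ?N)" 4] n by (simp add: field_simps)
  then have "expected_C4 n p * (1 - 4 * (real s + 3) / ?N)
      \<le> expected_C4 n p * (1 - (real s + 3) / ?N) ^ 4"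
    using E0 by (rule mult_left_mono)
  also have "\<dots> \<le> ?N ^ 4 * ?w * (1 - (real s + 3) / ?N) ^ 4"
    using E4 by (rule mult_right_mono) simp
  also have "\<dots> = (?N * (1 - (real s + 3) / ?N)) ^ 4 * ?w"
    by (simp add: power_mult_distrib)
  also have "?N * (1 - (real s + 3) / ?N) = y"
    using N by (simp add: y_def field_simps)
  also have "y ^ 4 * ?w \<le> ((?N - s) * (?N - s - 1) * (?N - s - 2) * (?N - s - 3)) * ?w"
  proof (rule mult_right_mono[OF _ w])
    show "y ^ 4 \<le> (?N - s) * (?N - s - 1) * (?N - s - 2) * (?N - s - 3)"
      unfolding power4_eq_xxxx using y by (intro mult_mono) auto
  qed
  also have "\<dots> = real ((n - s) choose 2) * real ((n - s - 2) choose 2) / 2 * p ^ 4 * (1 - p)\<^sup>2"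
    using n by (simp add: choose_two_real of_nat_diff)
  finally show ?thesis .
qed

text \<open>Weierstrass' product inequality, from the two-factor case applied to pairs and then to
  the two products.\<close>

lemma one_minus_prod_ge:
  fixes a b c d :: real
  assumes "0 \<le> a" "a \<le> 1" "0 \<le> b" "b \<le> 1" "0 \<le> c" "c \<le> 1" "0 \<le> d" "d \<le> 1"
  shows "1 - (a + b + c + d) \<le> (1 - a) * (1 - b) * (1 - c) * (1 - d)"
proof -
  have two: "1 - (x + y) \<le> (1 - x) * (1 - y)" if "0 \<le> x" "0 \<le> y" for x y :: real
    using that by (simp add: algebra_simps)
  have "1 - (a + b) \<le> (1 - a) * (1 - b)" "1 - (c + d) \<le> (1 - c) * (1 - d)"
    using assms by (auto intro: two)
  moreover have "0 \<le> (1 - a) * (1 - b)" "(1 - a) * (1 - b) \<le> 1" "0 \<le> (1 - c) * (1 - d)" "(1 - c) * (1 - d) \<le> 1"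
    using assms by (auto intro: mult_le_one)
  moreover from this have "1 - ((1 - (1 - a) * (1 - b)) + (1 - (1 - c) * (1 - d)))
      \<le> (1 - (1 - (1 - a) * (1 - b))) * (1 - (1 - (1 - c) * (1 - d)))"
    by (intro two) auto
  ultimately show ?thesis by (simp add: mult.assoc)
qed

text \<open>\<open>t^t / t!\<close> is a single term of the series for \<open>exp t\<close>.\<close>

lemma power_self_le_exp_fact: "real t ^ t \<le> exp (real t) * fact t"
proof -
  have "real t ^ t /\<^sub>R fact t \<le> (\<Sum>i. real t ^ i /\<^sub>R fact i)"
    using sum_le_suminf[OF sums_summable[OF exp_converges[of "real t"]], of "{t}"] by simp
  also have "\<dots> = exp (real t)" by (rule sums_unique[OF exp_converges, symmetric])
  finally show ?thesis by (simp add: field_simps)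
qed

lemma choose_le_exp_power:
  assumes "0 < t"
  shows "real (n choose t) \<le> (exp 1 * real n / real t) ^ t"
proof -
  have "real (n choose t) * fact t \<le> real n ^ t"
    using binomial_fact_pow[of n t] by (metis of_nat_fact of_nat_le_iff of_nat_mult of_nat_power)
  then have "(real (n choose t) * fact t) * exp (real t) \<le> real n ^ t * exp (real t)"
    by (rule mult_right_mono) simp
  moreover have "real (n choose t) * real t ^ t \<le> (real (n choose t) * fact t) * exp (real t)"
    unfolding mult.assoc
    using power_self_le_exp_fact[of t] by (intro mult_left_mono) (auto simp: mult.commute)
  moreover have "exp (real t) = exp 1 ^ t" by (simp flip: exp_of_nat_mult)
  ultimately have "real (n choose t) * real t ^ t \<le> (exp 1 * real n) ^ t"
    unfolding power_mult_distrib by (metis mult.commute order.trans)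
  then show ?thesis using assms by (simp add: power_divide field_simps)
qed

text \<open>Factor by factor, \<open>n - i \<le> 2 * (n - k - i)\<close>, which amounts to
  \<open>2 * k + i \<le> n\<close>. This prices choosing \<open>T\<close> outside \<open>S\<close>
  at a factor \<open>2^t\<close>.\<close>

lemma choose_shrink:
  assumes "2 * k + t \<le> n"
  shows "real (n choose t) \<le> 2 ^ t * real ((n - k) choose t)"
proof -
  have "real (n choose t) = (\<Prod>i = 0..<t. real (n - i) / real (t - i))"
    using assms by (intro binomial_altdef_of_nat) simp
  also have "\<dots> \<le> (\<Prod>i = 0..<t. 2 * (real (n - k - i) / real (t - i)))"
  proof (intro prod_mono conjI)
    fix i assume "i \<in> {0..<t}"
    then have "real (n - i) \<le> 2 * real (n - k - i)" using assms by auto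
    then show "real (n - i) / real (t - i) \<le> 2 * (real (n - k - i) / real (t - i))"
      by (simp add: divide_right_mono)
  qed auto
  also have "\<dots> = 2 ^ t * real ((n - k) choose t)"
  proof -
    have "real ((n - k) choose t) = (\<Prod>i = 0..<t. real (n - k - i) / real (t - i))"
      using assms by (intro binomial_altdef_of_nat) simp
    then show ?thesis by (simp only: prod.distrib prod_constant card_atLeastLessThan) simp
  qed
  finally show ?thesis .
qed

section \<open>The sparse range\<close>

text \<open>The asymptotic assumptions as explicit inequalities: \<open>e1\<close> bounds the
  relative loss in the expectation, \<open>e2\<close> keeps \<open>k\<close> and \<open>t\<close>
  small against \<open>n\<close>, \<open>e3\<close> controls further common neighbours, and
  \<open>e4\<close> to \<open>e7\<close> let the exponent \<open>1 + \<epsilon>\<close> absorb the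
  remaining factors.\<close>

lemma upper_tail_C4_sparse:
  fixes p \<epsilon> \<delta> C :: real
  defines "a \<equiv> \<delta> + \<epsilon>"
  defines "c \<equiv> sqrt a / (2 * C)"
  assumes pos: "0 < \<epsilon>" "0 < \<delta>" "0 < C" and p: "0 < p" "p \<le> 1 / 10" and n: "30 \<le> n"
    and k: "2 \<le> k" "real k \<le> C * real n * p"
    and kt: "real k * real t = m_seq \<delta> \<epsilon> (expected_C4 n p) k"
    and e1: "a * (1 / (c * (real n * p)) + 2 * p) + 4 * (C * p + 3 / real n) \<le> \<epsilon> / 2"
    and e2: "C * p \<le> 1 / 10" "sqrt a / 2 * (real n * p\<^sup>2) \<le> 1 / 2"
    and e3: "real n * p\<^sup>2 \<le> 1 / 2"
    and e4: "exp 1 / c * p powr (1 / 2) \<le> 1"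
    and e5: "p powr (\<epsilon> / 4) \<le> 1 / 2"
    and e6: "20 \<le> \<epsilon> * (c * (real n * p))"
    and e7: "p \<le> \<epsilon> / 64"
  shows "(p powr (real k * real t) * real (n choose t)) powr (1 + \<epsilon>) \<le> upper_tail_C4 n p \<delta>"
proof -
  let ?N = "real n"
  define \<mu> where "\<mu> = expected_C4 n p"
  have N: "30 \<le> ?N" using n by simp
  have a: "0 < a" using pos by (simp add: a_def)
  have c: "0 < c" using a pos by (simp add: c_def)
  have \<mu>: "?N ^ 4 * p ^ 4 / 16 \<le> \<mu>" "\<mu> \<le> ?N ^ 4 * p ^ 4 / 8"
    using expected_C4_bounds[of p n] p n by (auto simp: \<mu>_def)
  have "0 < ?N ^ 4 * p ^ 4 / 16" using N p by simp
  then have \<mu>0: "0 < \<mu>" using \<mu>(1) by linarith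
  have k1: "1 < real k" using k by simp
  have "(real k * real t)\<^sup>2 = 4 * (real k / (real k - 1)) * (a * \<mu>)"
    unfolding kt m_seq_def r_seq_def \<mu>_def[symmetric] a_def[symmetric]
    using k1 a \<mu>0 by (simp add: power_mult_distrib)
  then have "(real k * real t)\<^sup>2 * ((real k - 1) / real k) = 4 * a * \<mu>"
    using k1 by simp
  \<comment> \<open>\<open>r_seq\<close> is chosen for this identity:
    \<open>(k choose 2) * (t choose 2)\<close> becomes
    \<open>a * \<mu> * (1 - 1 / t)\<close>.\<close>
  then have kt2: "real k * (real k - 1) * (real t)\<^sup>2 = 4 * a * \<mu>"
    using k1 by (simp add: power2_eq_square mult_ac)
  \<comment> \<open>From \<open>k * (k - 1) \<le> (C * n * p)^2\<close> and
    \<open>\<mu> \<ge> (n * p)^4 / 16\<close>; this is the origin of \<open>c\<close>.\<close>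
  have t_lower: "c * (?N * p) \<le> real t"
  proof -
    have "a * (?N ^ 4 * p ^ 4 / 4) \<le> 4 * a * \<mu>" using \<mu>(1) a by simp
    also have "\<dots> \<le> (real k)\<^sup>2 * (real t)\<^sup>2"
      unfolding kt2[symmetric] using k1 by (intro mult_right_mono) (auto simp: power2_eq_square)
    also have "\<dots> \<le> (C * ?N * p)\<^sup>2 * (real t)\<^sup>2"
      using k by (intro mult_right_mono power_mono) auto
    finally have "(C * ?N * p)\<^sup>2 * (c * (?N * p))\<^sup>2 \<le> (C * ?N * p)\<^sup>2 * (real t)\<^sup>2"
      using pos a by (simp add: c_def power_mult_distrib power_divide field_simps power4_eq_xxxx power2_eq_square)
    then have "(c * (?N * p))\<^sup>2 \<le> (real t)\<^sup>2"
      using pos N p by (subst (asm) mult_le_cancel_left_pos) auto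
    then show ?thesis by (rule power2_le_imp_le) simp
  qed
  have t_upper: "real t \<le> sqrt a / 2 * (?N * p\<^sup>2) * ?N"
  proof -
    have "2 * (real t)\<^sup>2 \<le> real k * (real k - 1) * (real t)\<^sup>2"
    proof -
      have "2 * 1 \<le> real k * (real k - 1)" using k by (intro mult_mono) auto
      then show ?thesis by (intro mult_right_mono) auto
    qed
    also have "\<dots> \<le> 4 * a * (?N ^ 4 * p ^ 4 / 8)"
      unfolding kt2 using \<mu>(2) a by (intro mult_left_mono) auto
    finally have "(real t)\<^sup>2 \<le> (sqrt a / 2 * (?N * p\<^sup>2) * ?N)\<^sup>2"
      using a by (simp add: power_mult_distrib power_divide field_simps power4_eq_xxxx power2_eq_square)
    then show ?thesis using a by (rule_tac power2_le_imp_le) auto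
  qed
  have t0: "0 < c * (?N * p)" using c N p by simp
  then have tpos: "0 < real t" using t_lower by linarith
  then have t1: "1 \<le> real t" by simp
  have tn: "real t \<le> ?N / 2"
    using order.trans[OF t_upper mult_right_mono[OF e2(2), of ?N]] by simp
  have kN: "real k \<le> ?N / 10"
  proof -
    have "real k \<le> (C * p) * ?N" using k(2) by (simp add: mult_ac)
    from order.trans[OF this mult_right_mono[OF e2(1), of ?N]] show ?thesis by simp
  qed
  have nat_le: "2 * k + t \<le> n" "k + 3 \<le> n"
    using tn kN N by linarith+
  define L where "L = (real (k choose 2) * real (t choose 2)
      + real ((n - k) choose 2) * real ((n - k - 2) choose 2) / 2 * p ^ 4) * (1 - p)\<^sup>2"
  have L_ge: "(1 + \<delta> + \<epsilon> / 2) * \<mu> \<le> L"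
  proof -
    \<comment> \<open>The losses are \<open>1 / t\<close> from \<open>t choose 2\<close> and
      \<open>p\<close> for each missing diagonal; the summand 0 pads the four-factor
      inequality.\<close>
    have "a * \<mu> * (1 - (1 / (c * (?N * p)) + 2 * p)) \<le> a * \<mu> * (1 - (1 / real t + 0 + p + p))"
    proof -
      have "1 / real t \<le> 1 / (c * (?N * p))" using t_lower t0 by (intro divide_left_mono) auto
      then show ?thesis using a \<mu>0 by (intro mult_left_mono) auto
    qed
    also have "\<dots> \<le> a * \<mu> * ((1 - 1 / real t) * (1 - 0) * (1 - p) * (1 - p))"
      using a \<mu>0 p t1 by (intro mult_left_mono one_minus_prod_ge) auto
    also have "\<dots> = real k * (real k - 1) * (real t)\<^sup>2 / 4 * (1 - 1 / real t) * (1 - p)\<^sup>2"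
      unfolding kt2 by (simp add: power2_eq_square)
    also have "\<dots> = real (k choose 2) * real (t choose 2) * (1 - p)\<^sup>2"
      using tpos by (simp add: choose_two_real field_simps power2_eq_square)
    finally have 1: "a * \<mu> * (1 - (1 / (c * (?N * p)) + 2 * p))
      \<le> real (k choose 2) * real (t choose 2) * (1 - p)\<^sup>2" .
    have "real k / ?N \<le> C * p" using k(2) N by (simp add: field_simps)
    then have "\<mu> * (1 - 4 * (C * p + 3 / ?N)) \<le> \<mu> * (1 - 4 * (real k + 3) / ?N)"
      using \<mu>0 by (intro mult_left_mono) (auto simp: add_divide_distrib)
    also have "\<dots> \<le> real ((n - k) choose 2) * real ((n - k - 2) choose 2) / 2 * p ^ 4 * (1 - p)\<^sup>2"
      unfolding \<mu>_def using p n nat_le by (intro background_C4_ge) auto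
    finally have 2: "\<mu> * (1 - 4 * (C * p + 3 / ?N)) \<le> \<dots>" .
    have "(1 + \<delta> + \<epsilon> / 2) * \<mu> \<le>
        (1 + a - (a * (1 / (c * (?N * p)) + 2 * p) + 4 * (C * p + 3 / ?N))) * \<mu>"
      using e1 \<mu>0 by (intro mult_right_mono) (auto simp: a_def)
    also have "\<dots> = a * \<mu> * (1 - (1 / (c * (?N * p)) + 2 * p)) + \<mu> * (1 - 4 * (C * p + 3 / ?N))"
      by (simp add: algebra_simps)
    also have "\<dots> \<le> L" using add_mono[OF 1 2] unfolding L_def by (simp only: distrib_right)
    finally show ?thesis .
  qed
  define Z where "Z = p ^ (k * t) * real (n choose t)"
  have Z0: "0 \<le> Z" using p by (simp add: Z_def)
  have "real ((n - k) choose t) * p ^ (k * t) * (1 - ?N * p ^ k) * ((L - (1 + \<delta>) * \<mu>) / ?N ^ 4)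
      \<le> upper_tail_C4 n p \<delta>"
    unfolding upper_tail_C4_def \<mu>_def[symmetric]
  proof (rule upper_tail_planted_common_neighbours[OF _ _ _ _ _ L_def])
    have "(1 + \<delta>) * \<mu> \<le> (1 + \<delta> + \<epsilon> / 2) * \<mu>" using pos \<mu>0 by (intro mult_right_mono) auto
    then show "(1 + \<delta>) * \<mu> \<le> L" using L_ge by linarith
  qed (use p n pos \<mu>0 nat_le in auto)
  moreover have half: "1 / 2 \<le> 1 - ?N * p ^ k"
  proof -
    have "p ^ k \<le> p\<^sup>2" using p k by (intro power_decreasing) auto
    then have "?N * p ^ k \<le> ?N * p\<^sup>2" by (intro mult_left_mono) auto
    then show ?thesis using e3 by linarith
  qed
  \<comment> \<open>Three losses against the target \<open>Z\<close>: \<open>2^t\<close> for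
    choosing \<open>T\<close> outside \<open>S\<close>, \<open>1 / 2\<close> for exactness of the
    common neighbourhood, and \<open>\<epsilon> / 32 * p^4\<close> from reverse Markov.\<close>
  moreover have "(Z / 2 ^ t) * (1 / 2) * (\<epsilon> / 32 * p ^ 4)
    \<le> real ((n - k) choose t) * p ^ (k * t) * (1 - ?N * p ^ k) * ((L - (1 + \<delta>) * \<mu>) / ?N ^ 4)"
  proof (intro mult_mono)
    show "Z / 2 ^ t \<le> real ((n - k) choose t) * p ^ (k * t)"
      using choose_shrink[OF nat_le(1)] p by (simp add: Z_def field_simps)
    show "1 / 2 \<le> 1 - ?N * p ^ k" by (rule half)
    have "\<epsilon> / 2 * (?N ^ 4 * p ^ 4 / 16) \<le> \<epsilon> / 2 * \<mu>" using \<mu>(1) pos by (intro mult_left_mono) auto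
    also have "\<dots> \<le> L - (1 + \<delta>) * \<mu>" using L_ge by (simp add: algebra_simps)
    finally show "\<epsilon> / 32 * p ^ 4 \<le> (L - (1 + \<delta>) * \<mu>) / ?N ^ 4" using N by (simp add: field_simps)
  qed (use p pos half in \<open>auto intro!: mult_nonneg_nonneg\<close>)
  moreover have "Z * (p ^ 5 / 2 ^ t) \<le> (Z / 2 ^ t) * (1 / 2) * (\<epsilon> / 32 * p ^ 4)"
  proof -
    have "p * (Z * p ^ 4 / 2 ^ t) \<le> \<epsilon> / 64 * (Z * p ^ 4 / 2 ^ t)"
      using e7 Z0 p by (intro mult_right_mono) auto
    then show ?thesis by (simp add: power_Suc[of p 4, simplified] mult_ac)
  qed
  moreover have "Z powr (1 + \<epsilon>) \<le> Z * (p ^ 5 / 2 ^ t)"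
  proof -
    have "Z \<le> p ^ (k * t) * (exp 1 * ?N / real t) ^ t"
      unfolding Z_def using choose_le_exp_power[of t n] tpos p by (intro mult_left_mono) auto
    also have "\<dots> = (p ^ k * (exp 1 * ?N / real t)) ^ t"
      by (simp only: power_mult power_mult_distrib)
    also have "\<dots> \<le> (p powr (1 / 2)) ^ t"
    proof (intro power_mono)
      \<comment> \<open>As \<open>k \<ge> 2\<close> and \<open>t \<ge> c * n * p\<close>, the left
        side is at most a constant times \<open>p\<close>, which \<open>e4\<close> turns into
        \<open>p^(1/2)\<close>.\<close>
      have "p ^ k * (exp 1 * ?N / real t) \<le> p\<^sup>2 * (exp 1 * ?N / (c * (?N * p)))"
      proof (intro mult_mono)
        show "p ^ k \<le> p\<^sup>2" using p k by (intro power_decreasing) auto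
        show "exp 1 * ?N / real t \<le> exp 1 * ?N / (c * (?N * p))"
          using t_lower t0 by (intro divide_left_mono) auto
      qed (use p in auto)
      also have "\<dots> = (exp 1 / c * p powr (1 / 2)) * p powr (1 / 2)"
        using p N c by (simp add: field_simps power2_eq_square flip: powr_add)
      also have "\<dots> \<le> 1 * p powr (1 / 2)" using e4 by (intro mult_right_mono) auto
      finally show "p ^ k * (exp 1 * ?N / real t) \<le> p powr (1 / 2)" by simp
    qed (use p in auto)
    finally have "Z powr \<epsilon> \<le> ((p powr (1 / 2)) ^ t) powr \<epsilon>"
      using pos Z0 by (intro powr_mono2) auto
    \<comment> \<open>\<open>p^(\<epsilon> t / 2)\<close> is split in halves: one beats
      \<open>2^t\<close> through \<open>e5\<close>, the other is at most \<open>p^5\<close> through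
      \<open>e6\<close>.\<close>
    also have "\<dots> = (p powr (\<epsilon> / 4)) ^ t * p powr (\<epsilon> * real t / 4)"
    proof -
      have "(p powr (1 / 2)) ^ t = p powr (real t / 2)"
        using p by (simp add: powr_power)
      moreover have "(p powr (\<epsilon> / 4)) ^ t = p powr (real t * \<epsilon> / 4)"
        using p by (simp add: powr_power mult.commute)
      ultimately show ?thesis by (simp add: powr_powr mult.commute flip: powr_add)
    qed
    also have "\<dots> \<le> (1 / 2) ^ t * p powr 5"
    proof (intro mult_mono power_mono e5)
      have "20 \<le> \<epsilon> * real t"
        using e6 mult_left_mono[OF t_lower, of \<epsilon>] pos by linarith
      then show "p powr (\<epsilon> * real t / 4) \<le> p powr 5"
        using p by (intro powr_mono') auto
    qed auto
    also have "\<dots> = p ^ 5 / 2 ^ t" using p by (simp add: power_divide powr_numeral)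
    finally have "Z * Z powr \<epsilon> \<le> Z * (p ^ 5 / 2 ^ t)" using Z0 by (rule mult_left_mono)
    moreover have "Z powr (1 + \<epsilon>) = Z * Z powr \<epsilon>"
      using Z0 by (cases "Z = 0") (auto simp: powr_add)
    ultimately show ?thesis by simp
  qed
  moreover have "p powr (real k * real t) = p ^ (k * t)"
    using p powr_realpow[of p "k * t"] by simp
  ultimately show ?thesis unfolding Z_def by simp
qed

section \<open>The dense range\<close>

text \<open>With \<open>h = n / 2\<close> and \<open>s = 2 m / n\<close>, the mixed copies have the
  same order as those with diagonals in \<open>S\<close> and \<open>T\<close>, so the condition on
  \<open>x\<close> is quadratic. \<open>e1\<close> bounds the loss, \<open>e2\<close> and
  \<open>e3\<close> give \<open>1 \<le> s \<le> n / 4\<close>, and \<open>e4\<close> and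
  \<open>e5\<close> absorb the reverse Markov factor.\<close>

lemma upper_tail_C4_dense:
  fixes p \<epsilon> \<delta> :: real
  defines "x \<equiv> sqrt (16 * (\<delta> + 3 * \<epsilon> / 2) + (sqrt 2 / (1 + \<epsilon>))\<^sup>2) - sqrt 2 / (1 + \<epsilon>)"
  assumes pos: "0 < \<epsilon>" "0 < \<delta>" and p: "0 < p" "p \<le> 1 / 10" and n: "30 \<le> n"
    and h: "n = 2 * h" and sh: "real s * real h = m_star \<delta> \<epsilon> (expected_C4 n p)"
    and e1: "(\<delta> + 3 * \<epsilon> / 2) * (4 / (x * (real n * p\<^sup>2)) + 2 / real n + x * p\<^sup>2 + 2 * p)
      + 4 * (x * p\<^sup>2 / 2 + 3 / real n) \<le> \<epsilon>"
    and e2: "x * p\<^sup>2 \<le> 1 / 2"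
    and e3: "4 \<le> x * (real n * p\<^sup>2)"
    and e4: "20 \<le> \<epsilon> * (x * (real n * p\<^sup>2))"
    and e5: "p \<le> \<epsilon> / 32"
  shows "p powr ((1 + \<epsilon>) * (real s * real h)) \<le> upper_tail_C4 n p \<delta>"
proof -
  let ?N = "real n" and ?S = "real s" and ?H = "real h"
  define \<mu> where "\<mu> = expected_C4 n p"
  define b where "b = \<delta> + 3 * \<epsilon> / 2"
  define d where "d = sqrt 2 / (1 + \<epsilon>)"
  have N: "30 \<le> ?N" using n by simp
  have NH: "?N = 2 * ?H" using h by simp
  have b: "0 < b" using pos by (simp add: b_def)
  have d: "0 \<le> d" "d \<le> sqrt 2" using pos by (auto simp: d_def field_simps)
  have x_def': "x = sqrt (16 * b + d\<^sup>2) - d" by (simp add: x_def b_def d_def)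
  have "d < sqrt (16 * b + d\<^sup>2)" using b by (intro real_less_rsqrt) simp
  then have x: "0 < x" using d by (simp add: x_def')
  have "(x + d)\<^sup>2 = 16 * b + d\<^sup>2" using b by (simp add: x_def')
  \<comment> \<open>The equation that determines \<open>m_star\<close>: up to lower-order losses,
    copies with diagonals in \<open>S\<close> and \<open>T\<close> contribute at least
    \<open>x^2 \<mu> / 16\<close> and mixed ones at least \<open>2 d x \<mu> / 16\<close>, together
    \<open>b * \<mu>\<close>.\<close>
  then have xb: "x\<^sup>2 + 2 * d * x = 16 * b" by (simp add: power2_sum algebra_simps)
  have \<mu>: "?N ^ 4 * p ^ 4 / 16 \<le> \<mu>" "\<mu> \<le> ?N ^ 4 * p ^ 4 / 8"
    using expected_C4_bounds[of p n] p n by (auto simp: \<mu>_def)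
  have "0 < ?N ^ 4 * p ^ 4 / 16" using N p by simp
  then have \<mu>0: "0 < \<mu>" using \<mu>(1) by linarith
  define u where "u = ?N\<^sup>2 * p\<^sup>2"
  have u4: "u\<^sup>2 = ?N ^ 4 * p ^ 4" by (simp add: u_def power_mult_distrib flip: power_mult)
  have u0: "0 \<le> u" by (simp add: u_def)
  have sq: "u / 4 \<le> sqrt \<mu>" "sqrt 8 * sqrt \<mu> \<le> u" "sqrt \<mu> \<le> u / 2"
  proof -
    show "u / 4 \<le> sqrt \<mu>"
      using \<mu>(1) by (intro real_le_rsqrt) (simp add: u4 power_divide)
    show "sqrt 8 * sqrt \<mu> \<le> u"
      unfolding real_sqrt_mult[symmetric] using \<mu>(2) u0 by (intro real_le_lsqrt) (auto simp: u4)
    show "sqrt \<mu> \<le> u / 2"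
      using \<mu> \<mu>0 u0 by (intro real_le_lsqrt) (auto simp: u4 power_divide)
  qed
  have m: "?S * ?H = x * sqrt \<mu> / 2"
    unfolding sh m_star_def by (simp add: x_def' b_def d_def \<mu>_def Let_def)
  have S: "?S = x * sqrt \<mu> / ?N" using m NH N by (simp add: field_simps)
  have S_lower: "x * (?N * p\<^sup>2) / 4 \<le> ?S"
  proof -
    have "x * (u / 4) / ?N \<le> ?S" unfolding S using sq(1) x by (intro divide_right_mono mult_left_mono) auto
    then show ?thesis using N by (simp add: u_def power2_eq_square field_simps)
  qed
  have S_upper: "?S \<le> x * p\<^sup>2 / 2 * ?N"
  proof -
    have "?S \<le> x * (u / 2) / ?N" unfolding S using sq(3) x by (intro divide_right_mono mult_left_mono) auto
    then show ?thesis using N by (simp add: u_def power2_eq_square field_simps)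
  qed
  have S1: "1 \<le> ?S" using S_lower e3 by simp
  have "x * p\<^sup>2 / 2 \<le> 1 / 4" using e2 by simp
  from order.trans[OF S_upper mult_right_mono[OF this, of ?N]]
  have S_small: "?S \<le> ?N / 4" by simp
  have nat_le: "s + h \<le> n" "s + 3 \<le> n" using S_small N NH by linarith+
  have H1: "1 \<le> ?H" using NH N by linarith
  define L where "L = (real (s choose 2) * real (h choose 2)
      + real (s * (n - s - h)) * real (h choose 2) * p\<^sup>2
      + real ((n - s) choose 2) * real ((n - s - 2) choose 2) / 2 * p ^ 4) * (1 - p)\<^sup>2"
  have L_ge: "(1 + \<delta> + \<epsilon> / 2) * \<mu> \<le> L"
  proof -
    \<comment> \<open>A common loss factor for both kinds of copies: the terms come from
      \<open>s choose 2\<close>, from \<open>h choose 2\<close>, and from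
      \<open>n - s - h = h - s\<close>.\<close>
    define \<theta> where "\<theta> = (1 - 1 / ?S) * (1 - 1 / ?H) * (1 - ?S / ?H)"
    have SH: "?S / ?H \<le> x * p\<^sup>2" "?S / ?H \<le> 1" "1 / ?S \<le> 1" "1 / ?H \<le> 1"
      using S_upper S_small S1 H1 N NH by (auto simp: field_simps)
    have \<theta>0: "0 \<le> \<theta>" unfolding \<theta>_def using SH by simp
    have theta: "1 - (4 / (x * (?N * p\<^sup>2)) + 2 / ?N + x * p\<^sup>2 + 2 * p) \<le> \<theta> * (1 - p)\<^sup>2"
    proof -
      have "1 / ?S \<le> 1 / (x * (?N * p\<^sup>2) / 4)"
        using S_lower e3 S1 by (intro divide_left_mono) auto
      moreover have "1 / ?H = 2 / ?N" using NH by simp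
      moreover have p2: "1 - (1 - p)\<^sup>2 \<le> 2 * p" by (simp add: power2_eq_square algebra_simps)
      moreover have "(1 - p)\<^sup>2 \<le> 1" using p by (simp add: power_le_one)
      ultimately have "1 - (4 / (x * (?N * p\<^sup>2)) + 2 / ?N + x * p\<^sup>2 + 2 * p)
        \<le> 1 - (1 / ?S + 1 / ?H + ?S / ?H + (1 - (1 - p)\<^sup>2))"
        using SH by simp
      also have "\<dots> \<le> (1 - 1 / ?S) * (1 - 1 / ?H) * (1 - ?S / ?H) * (1 - (1 - (1 - p)\<^sup>2))"
        using SH \<open>(1 - p)\<^sup>2 \<le> 1\<close> by (intro one_minus_prod_ge) auto
      finally show ?thesis by (simp add: \<theta>_def)
    qed
    have first: "real (s choose 2) * real (h choose 2) \<ge> x\<^sup>2 * \<mu> / 16 * \<theta>"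
    proof -
      have eq: "x\<^sup>2 * \<mu> / 16 = (?S * ?H)\<^sup>2 / 4"
        unfolding m using \<mu>0 by (simp add: power_mult_distrib power_divide)
      have "\<theta> \<le> (1 - 1 / ?S) * (1 - 1 / ?H) * 1"
        unfolding \<theta>_def using SH by (intro mult_left_mono) auto
      then have "x\<^sup>2 * \<mu> / 16 * \<theta> \<le> (?S * ?H)\<^sup>2 / 4 * ((1 - 1 / ?S) * (1 - 1 / ?H))"
        unfolding eq by (intro mult_left_mono) auto
      also have "\<dots> = real (s choose 2) * real (h choose 2)"
        using S1 H1 by (simp add: choose_two_real field_simps power2_eq_square)
      finally show ?thesis .
    qed
    have second: "real (s * (n - s - h)) * real (h choose 2) * p\<^sup>2 \<ge> d * x * \<mu> / 8 * \<theta>"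
    proof -
      have "d * x * \<mu> / 8 \<le> sqrt 2 * x * \<mu> / 8"
        using d x \<mu>0 by (intro divide_right_mono mult_right_mono) auto
      \<comment> \<open>Splitting \<open>\<mu>\<close> into two roots exposes
        \<open>s * h = x * sqrt \<mu> / 2\<close>; the other root is compared with \<open>u\<close>,
        since the mixed copies number about \<open>s * h * u / 8\<close>.\<close>
      also have "\<dots> = x * sqrt \<mu> / 2 * (sqrt 8 * sqrt \<mu>) / 8"
      proof -
        have "sqrt 8 = 2 * sqrt (2::real)" using real_sqrt_mult[of 4 2] by simp
        then show ?thesis using \<mu>0 by simp
      qed
      also have "\<dots> \<le> ?S * ?H * u / 8"
        unfolding m using sq(2) x \<mu>0 by (intro divide_right_mono mult_left_mono) auto
      finally have "d * x * \<mu> / 8 * \<theta> \<le> ?S * ?H * u / 8 * \<theta>"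
        using \<theta>0 by (rule mult_right_mono)
      also have "\<dots> \<le> ?S * ?H * u / 8 * ((1 - 1 / ?H) * (1 - ?S / ?H))"
      proof (rule mult_left_mono)
        have "(1 - 1 / ?S) * ((1 - 1 / ?H) * (1 - ?S / ?H)) \<le> 1 * ((1 - 1 / ?H) * (1 - ?S / ?H))"
          using SH S1 by (intro mult_right_mono) auto
        then show "\<theta> \<le> (1 - 1 / ?H) * (1 - ?S / ?H)" by (simp add: \<theta>_def mult.assoc)
      qed (use u0 in simp)
      also have "\<dots> = ?S * (?H - ?S) * (?H * (?H - 1) / 2) * p\<^sup>2"
        unfolding u_def NH using H1 by (simp add: field_simps power2_eq_square)
      also have "\<dots> = real (s * (n - s - h)) * real (h choose 2) * p\<^sup>2"
        using nat_le h by (simp add: choose_two_real of_nat_diff)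
      finally show ?thesis .
    qed
    have "b * \<mu> * (1 - (4 / (x * (?N * p\<^sup>2)) + 2 / ?N + x * p\<^sup>2 + 2 * p)) \<le> b * \<mu> * (\<theta> * (1 - p)\<^sup>2)"
      using theta b \<mu>0 by (intro mult_left_mono) auto
    also have "\<dots> = (x\<^sup>2 * \<mu> / 16 * \<theta> + d * x * \<mu> / 8 * \<theta>) * (1 - p)\<^sup>2"
    proof -
      have b_eq: "b = (x\<^sup>2 + 2 * d * x) / 16" using xb by simp
      show ?thesis unfolding b_eq by (simp add: field_simps)
    qed
    also have "\<dots> \<le> (real (s choose 2) * real (h choose 2)
      + real (s * (n - s - h)) * real (h choose 2) * p\<^sup>2) * (1 - p)\<^sup>2"
      using first second by (intro mult_right_mono add_mono) auto
    finally have 1: "b * \<mu> * (1 - (4 / (x * (?N * p\<^sup>2)) + 2 / ?N + x * p\<^sup>2 + 2 * p)) \<le> \<dots>" .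
    have "?S / ?N \<le> x * p\<^sup>2 / 2" using S_upper N by (simp add: field_simps)
    then have "\<mu> * (1 - 4 * (x * p\<^sup>2 / 2 + 3 / ?N)) \<le> \<mu> * (1 - 4 * (?S + 3) / ?N)"
      using \<mu>0 by (intro mult_left_mono) (auto simp: add_divide_distrib)
    also have "\<dots> \<le> real ((n - s) choose 2) * real ((n - s - 2) choose 2) / 2 * p ^ 4 * (1 - p)\<^sup>2"
      unfolding \<mu>_def using p n nat_le by (intro background_C4_ge) auto
    finally have 2: "\<mu> * (1 - 4 * (x * p\<^sup>2 / 2 + 3 / ?N)) \<le> \<dots>" .
    define \<eta> where "\<eta> = 4 / (x * (?N * p\<^sup>2)) + 2 / ?N + x * p\<^sup>2 + 2 * p"
    define \<zeta> where "\<zeta> = 4 * (x * p\<^sup>2 / 2 + 3 / ?N)"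
    have "b * \<eta> + \<zeta> \<le> \<epsilon>" using e1 by (simp only: b_def \<eta>_def \<zeta>_def)
    then have "(1 + \<delta> + \<epsilon> / 2) * \<mu> \<le> (1 + b - (b * \<eta> + \<zeta>)) * \<mu>"
      using \<mu>0 by (intro mult_right_mono) (auto simp: b_def)
    also have "\<dots> = b * \<mu> * (1 - \<eta>) + \<mu> * (1 - \<zeta>)"
      by (simp add: algebra_simps)
    also have "\<dots> \<le> L"
      using add_mono[OF 1 2] unfolding L_def \<eta>_def \<zeta>_def by (simp only: distrib_right)
    finally show ?thesis .
  qed
  have "p ^ (s * h) * ((L - (1 + \<delta>) * \<mu>) / ?N ^ 4) \<le> upper_tail_C4 n p \<delta>"
    unfolding upper_tail_C4_def \<mu>_def[symmetric]
  proof (rule upper_tail_planted_bipartite[OF _ _ _ _ _ L_def])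
    have "(1 + \<delta>) * \<mu> \<le> (1 + \<delta> + \<epsilon> / 2) * \<mu>" using pos \<mu>0 by (intro mult_right_mono) auto
    then show "(1 + \<delta>) * \<mu> \<le> L" using L_ge by linarith
  qed (use p n pos \<mu>0 nat_le in auto)
  moreover have "p ^ (s * h) * (p powr (\<epsilon> * (?S * ?H))) \<le> p ^ (s * h) * ((L - (1 + \<delta>) * \<mu>) / ?N ^ 4)"
  proof (rule mult_left_mono)
    \<comment> \<open>\<open>s * h \<ge> s\<close> already makes \<open>\<epsilon> * s * h\<close>
      at least 5; then \<open>p^5 \<le> \<epsilon> / 32 * p^4\<close> pays for reverse
      Markov.\<close>
    have "?S * 1 \<le> ?S * ?H" using H1 by (intro mult_left_mono) auto
    then have "\<epsilon> * (x * (?N * p\<^sup>2) / 4) \<le> \<epsilon> * (?S * ?H)"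
      using S_lower pos by (intro mult_left_mono) auto
    then have "5 \<le> \<epsilon> * (?S * ?H)" using e4 by simp
    then have "p powr (\<epsilon> * (?S * ?H)) \<le> p powr 5" using p by (intro powr_mono') auto
    also have "\<dots> = p * p ^ 4" using p by (simp add: powr_numeral power_Suc[of p 4, simplified])
    also have "\<dots> \<le> \<epsilon> / 32 * p ^ 4" using e5 by (intro mult_right_mono) auto
    also have "\<dots> \<le> (L - (1 + \<delta>) * \<mu>) / ?N ^ 4"
    proof -
      have "\<epsilon> / 2 * (?N ^ 4 * p ^ 4 / 16) \<le> \<epsilon> / 2 * \<mu>" using \<mu>(1) pos by (intro mult_left_mono) auto
      also have "\<dots> \<le> L - (1 + \<delta>) * \<mu>" using L_ge by (simp add: algebra_simps)
      finally show ?thesis using N by (simp add: field_simps)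
    qed
    finally show "p powr (\<epsilon> * (?S * ?H)) \<le> (L - (1 + \<delta>) * \<mu>) / ?N ^ 4" .
  qed (use p in simp)
  moreover have "p powr ((1 + \<epsilon>) * (?S * ?H)) = p ^ (s * h) * (p powr (\<epsilon> * (?S * ?H)))"
    using p powr_realpow[of p "s * h"] by (simp add: distrib_right powr_add)
  ultimately show ?thesis by linarith
qed

section \<open>From asymptotic notation to explicit inequalities\<close>

lemma floor_quotient_of_Ints:
  fixes y :: real
  assumes "y \<in> \<int>" "0 \<le> y"
  shows "real (nat \<lfloor>y\<rfloor>) = y"
  using assms by (auto elim!: Ints_cases)

theorem theorem4p1:
  fixes \<epsilon> \<delta> C :: real and p :: "nat \<Rightarrow> real" and k :: "nat \<Rightarrow> nat"
  assumes "\<epsilon> > 0" and "\<delta> > 0" and "C > 0"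
    and "\<And>n. 0 \<le> p n \<and> p n \<le> 1"
    and "eventually (\<lambda>n. 2 \<le> k n \<and> real (k n) \<le> C * real n * p n) sequentially"
  shows
    "((\<lambda>n. 1 / real n) \<in> o(p) \<and> p \<in> o(\<lambda>n. real n powr (- 1 / 2)) \<longrightarrow>
       eventually (\<lambda>n.
         let m = m_seq \<delta> \<epsilon> (expected_C4 n (p n)) (k n)
         in m / real (k n) \<in> \<int> \<longrightarrow>
            upper_tail_C4 n (p n) \<delta>
              \<ge> (p n powr m * real (n choose nat \<lfloor>m / real (k n)\<rfloor>)) powr (1 + \<epsilon>))
         sequentially) \<and>
     ((\<lambda>n. real n powr (- 1 / 2)) \<in> o(p) \<and> p \<in> o(\<lambda>n. 1) \<longrightarrow>
       eventually (\<lambda>n.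
         let m = m_star \<delta> \<epsilon> (expected_C4 n (p n))
         in 2 * m / real n \<in> \<int> \<and> even n \<longrightarrow>
            upper_tail_C4 n (p n) \<delta> \<ge> p n powr ((1 + \<epsilon>) * m))
         sequentially)"
proof (intro conjI impI)
  assume "(\<lambda>n. 1 / real n) \<in> o(p) \<and> p \<in> o(\<lambda>n. real n powr (- 1 / 2))"
  then have small: "(\<lambda>n. 1 / real n) \<in> o(p)" "p \<in> o(\<lambda>n. real n powr (- 1 / 2))" by auto
  define a where "a = \<delta> + \<epsilon>"
  define c where "c = sqrt a / (2 * C)"
  have ac: "0 < a" "0 < c" using assms(1-3) by (auto simp: a_def c_def)
  have lim_n: "(\<lambda>n. 1 / real n) \<longlonglongrightarrow> 0" by (rule lim_1_over_n)
  have lim_np: "(\<lambda>n. 1 / (real n * p n)) \<longlonglongrightarrow> 0"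
    using smalloD_tendsto[OF small(1)] by simp
  have lim_root: "(\<lambda>n. p n / real n powr (- 1 / 2)) \<longlonglongrightarrow> 0"
    using smalloD_tendsto[OF small(2)] by simp
  have lim_np2: "(\<lambda>n. real n * (p n)\<^sup>2) \<longlonglongrightarrow> 0"
  proof -
    have eq: "(p n / real n powr (- 1 / 2))\<^sup>2 = real n * (p n)\<^sup>2" for n
      by (simp add: power_divide powr_minus powr_half_sqrt field_simps)
    from tendsto_power[OF lim_root, of 2] show ?thesis
      unfolding eq by (simp only: power_zero_numeral)
  qed
  have lim_p: "p \<longlonglongrightarrow> 0"
  proof -
    have "(\<lambda>n. p n / real n powr (- 1 / 2) * real n powr (- 1 / 2)) \<longlonglongrightarrow> 0 * 0"
      using lim_root by (intro tendsto_mult tendsto_neg_powr filterlim_real_sequentially) auto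
    \<comment> \<open>The cancellation fails at \<open>n = 0\<close>, where the division is by zero,
      so the identity is only eventual.\<close>
    moreover have "eventually (\<lambda>n. p n / real n powr (- 1 / 2) * real n powr (- 1 / 2) = p n) sequentially"
      using eventually_gt_at_top[of 0] by eventually_elim simp
    ultimately show ?thesis by (simp add: tendsto_cong)
  qed
  have "(\<lambda>n. a * (1 / c * (1 / (real n * p n)) + 2 * p n) + 4 * (C * p n + 3 * (1 / real n)))
      \<longlonglongrightarrow> a * (1 / c * 0 + 2 * 0) + 4 * (C * 0 + 3 * 0)"
    by (intro tendsto_intros lim_p lim_np lim_n)
  then have e1: "eventually (\<lambda>n. a * (1 / c * (1 / (real n * p n)) + 2 * p n)
      + 4 * (C * p n + 3 * (1 / real n)) < \<epsilon> / 2) sequentially"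
    by (rule order_tendstoD(2)) (use assms(1) in simp)
  have "(\<lambda>n. sqrt a / 2 * (real n * (p n)\<^sup>2)) \<longlonglongrightarrow> sqrt a / 2 * 0"
    by (intro tendsto_intros lim_np2)
  then have e2: "eventually (\<lambda>n. sqrt a / 2 * (real n * (p n)\<^sup>2) < 1 / 2) sequentially"
    by (rule order_tendstoD(2)) simp
  have "(\<lambda>n. exp 1 / c * p n powr (1 / 2)) \<longlonglongrightarrow> exp 1 / c * 0"
    by (intro tendsto_intros tendsto_zero_powrI[OF lim_p tendsto_const]) (simp_all add: assms(4))
  then have e4: "eventually (\<lambda>n. exp 1 / c * p n powr (1 / 2) < 1) sequentially"
    by (rule order_tendstoD(2)) simp
  have "(\<lambda>n. p n powr (\<epsilon> / 4)) \<longlonglongrightarrow> 0"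
    using assms(1) by (intro tendsto_zero_powrI[OF lim_p tendsto_const]) (simp_all add: assms(4))
  then have e5: "eventually (\<lambda>n. p n powr (\<epsilon> / 4) < 1 / 2) sequentially"
    by (rule order_tendstoD(2)) simp
  have e6: "eventually (\<lambda>n. 1 / (real n * p n) < \<epsilon> * c / 20) sequentially"
    using assms(1) ac by (intro order_tendstoD(2)[OF lim_np]) auto
  have e3: "eventually (\<lambda>n. real n * (p n)\<^sup>2 < 1 / 2) sequentially"
    by (intro order_tendstoD(2)[OF lim_np2]) auto
  have ep: "eventually (\<lambda>n. p n < min (min (1 / 10) (\<epsilon> / 64)) (1 / (10 * C))) sequentially"
    using assms(1,3) by (intro order_tendstoD(2)[OF lim_p]) auto
  \<comment> \<open>Besides the limits, \<open>1 / n \<ll> p\<close> supplies strict positivity: it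
    gives \<open>1 / n \<le> p n\<close> eventually, whereas the assumption on \<open>p\<close>
    allows 0.\<close>
  have epos: "eventually (\<lambda>n. norm (1 / real n) \<le> 1 * norm (p n)) sequentially"
    by (rule landau_o.smallD[OF small(1)]) simp
  show "eventually (\<lambda>n.
         let m = m_seq \<delta> \<epsilon> (expected_C4 n (p n)) (k n)
         in m / real (k n) \<in> \<int> \<longrightarrow>
            upper_tail_C4 n (p n) \<delta>
              \<ge> (p n powr m * real (n choose nat \<lfloor>m / real (k n)\<rfloor>)) powr (1 + \<epsilon>))
         sequentially"
    using e1 e2 e3 e4 e5 e6 ep epos assms(5) eventually_ge_at_top[of 30]
  proof eventually_elim
    case (elim n)
    have n0: "0 < real n" using elim by simp
    have "1 / real n \<le> p n" using elim(8) assms(4)[of n] by simp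
    with n0 have p0: "0 < p n" by (auto intro: less_le_trans[of 0 "1 / real n"])
    define m where "m = m_seq \<delta> \<epsilon> (expected_C4 n (p n)) (k n)"
    show ?case
      unfolding Let_def m_def[symmetric]
    proof
      assume int: "m / real (k n) \<in> \<int>"
      define t where "t = nat \<lfloor>m / real (k n)\<rfloor>"
      have "0 \<le> expected_C4 n (p n)"
        unfolding expected_C4_def by (intro Bochner_Integration.integral_nonneg) auto
      \<comment> \<open>Nonnegativity keeps \<open>nat\<close> from truncating, so the floor
        recovers the integer \<open>m / k\<close> exactly.\<close>
      then have "0 \<le> m"
        using elim assms(1,2) by (auto simp: m_def m_seq_def r_seq_def)
      then have "real t = m / real (k n)"
        unfolding t_def using int by (intro floor_quotient_of_Ints) auto
      then have kt: "real (k n) * real t = m" using elim by auto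
      have "(p n powr (real (k n) * real t) * real (n choose t)) powr (1 + \<epsilon>)
          \<le> upper_tail_C4 n (p n) \<delta>"
      proof (rule upper_tail_C4_sparse)
        show "20 \<le> \<epsilon> * (sqrt (\<delta> + \<epsilon>) / (2 * C) * (real n * p n))"
          using elim p0 n0 unfolding a_def[symmetric] c_def[symmetric] by (simp add: field_simps)
        show "(\<delta> + \<epsilon>) * (1 / (sqrt (\<delta> + \<epsilon>) / (2 * C) * (real n * p n)) + 2 * p n) +
            4 * (C * p n + 3 / real n) \<le> \<epsilon> / 2"
          using elim(1) unfolding a_def[symmetric] c_def[symmetric] by simp
        show "C * p n \<le> 1 / 10" using elim assms(3) by (simp add: field_simps)
        show "exp 1 / (sqrt (\<delta> + \<epsilon>) / (2 * C)) * p n powr (1 / 2) \<le> 1"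
          using elim unfolding a_def[symmetric] c_def[symmetric] by simp
        show "sqrt (\<delta> + \<epsilon>) / 2 * (real n * (p n)\<^sup>2) \<le> 1 / 2"
          using elim unfolding a_def[symmetric] by simp
      qed (use elim assms(1-3) p0 kt in \<open>auto simp: m_def\<close>)
      then show "(p n powr m * real (n choose nat \<lfloor>m / real (k n)\<rfloor>)) powr (1 + \<epsilon>)
          \<le> upper_tail_C4 n (p n) \<delta>"
        unfolding kt t_def[symmetric] .
    qed
  qed
next
  assume "(\<lambda>n. real n powr (- 1 / 2)) \<in> o(p) \<and> p \<in> o(\<lambda>n. 1)"
  then have small: "(\<lambda>n. real n powr (- 1 / 2)) \<in> o(p)" "p \<in> o(\<lambda>n. 1)" by auto
  define d where "d = sqrt 2 / (1 + \<epsilon>)"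
  define b where "b = \<delta> + 3 * \<epsilon> / 2"
  define x where "x = sqrt (16 * b + d\<^sup>2) - d"
  have b: "0 < b" using assms(1,2) by (simp add: b_def)
  have "d < sqrt (16 * b + d\<^sup>2)" using b by (intro real_less_rsqrt) simp
  then have x: "0 < x" by (simp add: x_def)
  have lim_n: "(\<lambda>n. 1 / real n) \<longlonglongrightarrow> 0" by (rule lim_1_over_n)
  have lim_p: "p \<longlonglongrightarrow> 0"
    using smalloD_tendsto[OF small(2)] by simp
  \<comment> \<open>Squaring the quotient in \<open>n^(-1/2) \<ll> p\<close> shows that
    \<open>n * p^2\<close> tends to infinity, which makes the planted side \<open>S\<close>
    large.\<close>
  have lim_np2: "(\<lambda>n. 1 / (real n * (p n)\<^sup>2)) \<longlonglongrightarrow> 0"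
  proof -
    have eq: "(real n powr (- 1 / 2) / p n)\<^sup>2 = 1 / (real n * (p n)\<^sup>2)" for n
      by (simp add: power_divide powr_minus powr_half_sqrt field_simps)
    from tendsto_power[OF smalloD_tendsto[OF small(1)], of 2] show ?thesis
      unfolding eq by (simp only: power_zero_numeral)
  qed
  have "(\<lambda>n. b * (4 / x * (1 / (real n * (p n)\<^sup>2)) + 2 * (1 / real n) + x * (p n)\<^sup>2 + 2 * p n)
      + 4 * (x * (p n)\<^sup>2 / 2 + 3 * (1 / real n)))
    \<longlonglongrightarrow> b * (4 / x * 0 + 2 * 0 + x * 0\<^sup>2 + 2 * 0) + 4 * (x * 0\<^sup>2 / 2 + 3 * 0)"
    by (intro tendsto_intros lim_p lim_np2 lim_n) auto
  then have e1: "eventually (\<lambda>n. b * (4 / x * (1 / (real n * (p n)\<^sup>2)) + 2 * (1 / real n)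
      + x * (p n)\<^sup>2 + 2 * p n) + 4 * (x * (p n)\<^sup>2 / 2 + 3 * (1 / real n)) < \<epsilon>) sequentially"
    by (rule order_tendstoD(2)) (use assms(1) in simp)
  have "(\<lambda>n. x * (p n)\<^sup>2) \<longlonglongrightarrow> x * 0\<^sup>2" by (intro tendsto_intros lim_p)
  then have e2: "eventually (\<lambda>n. x * (p n)\<^sup>2 < 1 / 2) sequentially"
    by (rule order_tendstoD(2)) simp
  have e3: "eventually (\<lambda>n. 1 / (real n * (p n)\<^sup>2) < min (x / 4) (\<epsilon> * x / 20)) sequentially"
    using assms(1) x by (intro order_tendstoD(2)[OF lim_np2]) auto
  have ep: "eventually (\<lambda>n. p n < min (1 / 10) (\<epsilon> / 32)) sequentially"
    using assms(1) by (intro order_tendstoD(2)[OF lim_p]) auto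
  have epos: "eventually (\<lambda>n. norm (real n powr (- 1 / 2)) \<le> 1 * norm (p n)) sequentially"
    by (rule landau_o.smallD[OF small(1)]) simp
  show "eventually (\<lambda>n.
         let m = m_star \<delta> \<epsilon> (expected_C4 n (p n))
         in 2 * m / real n \<in> \<int> \<and> even n \<longrightarrow>
            upper_tail_C4 n (p n) \<delta> \<ge> p n powr ((1 + \<epsilon>) * m))
         sequentially"
    using e1 e2 e3 ep epos eventually_ge_at_top[of 30]
  proof eventually_elim
    case (elim n)
    have n0: "0 < real n" using elim by simp
    have "real n powr (- 1 / 2) \<le> p n" using elim(5) assms(4)[of n] by simp
    with n0 have p0: "0 < p n" by (auto intro: less_le_trans[of 0 "real n powr (- 1 / 2)"])
    define m where "m = m_star \<delta> \<epsilon> (expected_C4 n (p n))"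
    show ?case
      unfolding Let_def m_def[symmetric]
    proof
      assume int: "2 * m / real n \<in> \<int> \<and> even n"
      define s where "s = nat \<lfloor>2 * m / real n\<rfloor>"
      define h where "h = n div 2"
      have h: "n = 2 * h" using int by (simp add: h_def)
      have "0 \<le> expected_C4 n (p n)"
        unfolding expected_C4_def by (intro Bochner_Integration.integral_nonneg) auto
      moreover have m_eq: "m = x * sqrt (expected_C4 n (p n)) / 2"
        by (simp add: m_def m_star_def Let_def x_def b_def d_def)
      ultimately have "0 \<le> m" unfolding m_eq using x by simp
      then have "real s = 2 * m / real n"
        unfolding s_def using int by (intro floor_quotient_of_Ints) auto
      then have sh: "real s * real h = m" using n0 h by (simp add: field_simps)
      have np2: "0 < real n * (p n)\<^sup>2" using n0 p0 by simp
      have "p n powr ((1 + \<epsilon>) * (real s * real h)) \<le> upper_tail_C4 n (p n) \<delta>"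
      proof (rule upper_tail_C4_dense, unfold d_def[symmetric] b_def[symmetric], unfold x_def[symmetric])
        show "b * (4 / (x * (real n * (p n)\<^sup>2)) + 2 / real n + x * (p n)\<^sup>2 + 2 * p n)
          + 4 * (x * (p n)\<^sup>2 / 2 + 3 / real n) \<le> \<epsilon>"
          using elim(1) by simp
        show "4 \<le> x * (real n * (p n)\<^sup>2)" "20 \<le> \<epsilon> * (x * (real n * (p n)\<^sup>2))"
          using elim(3) np2 by (simp_all add: field_simps)
      qed (use elim assms(1,2) p0 sh h in \<open>auto simp: m_def\<close>)
      then show "p n powr ((1 + \<epsilon>) * m) \<le> upper_tail_C4 n (p n) \<delta>"
        by (simp only: sh)
    qed
  qed
qed

end
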